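(* Let $\phi(x,y)$ be a first-order formula over a signature consisting of unary predicates and binary relation symbols $(R_a)_{a\in A}$. Over finite structures, $\phi(x,y)$ is safe for bisimulation if and only if $\phi(x,y)$ is equivalent, over finite structures, to $ST_{x,y}(\pi)$ for some modal program $\pi$.
   Context: Structures over this signature are Kripke models: the unary predicate $P$ corresponds to propositional variable $p$, $R_a$ to modality $a$. A bisimulation between Kripke models $M,M'$ is a relation $Z\subseteq W\times W'$ such that $Z$-related points satisfy the same unary predicates, and for each $a$: if $wZw'$ and $R_a(w,v)$ then there is $v'$ with $R'_a(w',v')$ and $vZv'$, and conversely. $\phi(x,y)$ is safe for bisimulation over finite structures if for every bisimulation $Z$ between finite Kripke models $M,M'$, whenever $wZw'$ and $M\models\phi(w,v)$ there is $v'$ with $M'\models\phi(w',v')$ and $vZv'$, and whenever $wZw'$ and $M'\models\phi(w',v')$ there is $v$ with $M\models\phi(w,v)$ and $vZv'$. Modal programs are given by the grammar $\pi::= p?\mid a\mid \pi;\pi'\mid\pi\cup\pi'\mid{\sim}\pi$ ($p$ a propositional variable, $a\in A$). Their translation: $ST_{x,y}(a)=R_a(x,y)$; $ST_{x,y}(p?)=(x=y)\land P(x)$; $ST_{x,y}(\pi;\pi')=\exists z(ST_{x,z}(\pi)\land ST_{z,y}(\pi'))$; $ST_{x,y}(\pi\cup\pi')=ST_{x,y}(\pi)\lor ST_{x,y}(\pi')$; $ST_{x,y}({\sim}\pi)=(x=y)\land\neg\exists z\,ST_{x,z}(\pi)$ (with fresh variables as needed).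
   Formalization: The signature is assumed to contain at least one unary predicate or one binary relation symbol; over the empty signature the grammar generates no modal program, although x = y is safe for bisimulation, so the claim fails there. *)

theory Defs
  imports Main
begin

text \<open>
  First-order formulas with equality over unary predicates indexed by \<open>'p\<close> and binary relation
  symbols indexed by \<open>'a\<close>. A signature is a pair of sets \<open>P :: 'p set\<close>, \<open>A :: 'a set\<close>, so that
  either kind of symbol may be absent; \<open>fm_preds\<close> and \<open>fm_rels\<close> (the datatype's set functions)
  give the symbols occurring in a formula.
\<close>

datatype (fm_preds: 'p, fm_rels: 'a) fm =
    FEq nat nat
  | FPred 'p nat
  | FRel 'a nat nat
  | FNeg "('p, 'a) fm"
  | FConj "('p, 'a) fm" "('p, 'a) fm"
  | FDisj "('p, 'a) fm" "('p, 'a) fm"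
  | FEx nat "('p, 'a) fm"
  | FAll nat "('p, 'a) fm"

primrec fv :: "('p, 'a) fm \<Rightarrow> nat set" where
  "fv (FEq x y) = {x, y}"
| "fv (FPred p x) = {x}"
| "fv (FRel a x y) = {x, y}"
| "fv (FNeg \<phi>) = fv \<phi>"
| "fv (FConj \<phi> \<psi>) = fv \<phi> \<union> fv \<psi>"
| "fv (FDisj \<phi> \<psi>) = fv \<phi> \<union> fv \<psi>"
| "fv (FEx z \<phi>) = fv \<phi> - {z}"
| "fv (FAll z \<phi>) = fv \<phi> - {z}"

definition formula_over :: "'p set \<Rightarrow> 'a set \<Rightarrow> ('p, 'a) fm \<Rightarrow> bool" where
  "formula_over P A \<phi> \<longleftrightarrow> fm_preds \<phi> \<subseteq> P \<and> fm_rels \<phi> \<subseteq> A"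

record ('w, 'p, 'a) kripke =
  worlds :: "'w set"
  val :: "'p \<Rightarrow> 'w set"
  acc :: "'a \<Rightarrow> ('w \<times> 'w) set"

definition finite_model :: "'p set \<Rightarrow> 'a set \<Rightarrow> ('w, 'p, 'a) kripke \<Rightarrow> bool" where
  "finite_model P A M \<longleftrightarrow> finite (worlds M) \<and> worlds M \<noteq> {} \<and>
     (\<forall>p\<in>P. val M p \<subseteq> worlds M) \<and> (\<forall>a\<in>A. acc M a \<subseteq> worlds M \<times> worlds M)"

primrec sat :: "('w, 'p, 'a) kripke \<Rightarrow> (nat \<Rightarrow> 'w) \<Rightarrow> ('p, 'a) fm \<Rightarrow> bool" where
  "sat M s (FEq x y) \<longleftrightarrow> s x = s y"
| "sat M s (FPred p x) \<longleftrightarrow> s x \<in> val M p"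
| "sat M s (FRel a x y) \<longleftrightarrow> (s x, s y) \<in> acc M a"
| "sat M s (FNeg \<phi>) \<longleftrightarrow> \<not> sat M s \<phi>"
| "sat M s (FConj \<phi> \<psi>) \<longleftrightarrow> sat M s \<phi> \<and> sat M s \<psi>"
| "sat M s (FDisj \<phi> \<psi>) \<longleftrightarrow> sat M s \<phi> \<or> sat M s \<psi>"
| "sat M s (FEx z \<phi>) \<longleftrightarrow> (\<exists>u\<in>worlds M. sat M (s(z := u)) \<phi>)"
| "sat M s (FAll z \<phi>) \<longleftrightarrow> (\<forall>u\<in>worlds M. sat M (s(z := u)) \<phi>)"

text \<open>
  \<open>M \<Turnstile> \<phi>(w, v)\<close>, where the two argument places are the variables \<open>x\<close> and \<open>y\<close>. It is used only for
  \<open>fv \<phi> \<subseteq> {x, y}\<close>, so the value given to the other variables is immaterial.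
\<close>

definition sat2 ::
  "('w, 'p, 'a) kripke \<Rightarrow> nat \<Rightarrow> nat \<Rightarrow> ('p, 'a) fm \<Rightarrow> 'w \<Rightarrow> 'w \<Rightarrow> bool" where
  "sat2 M x y \<phi> w v \<longleftrightarrow>
     w \<in> worlds M \<and> v \<in> worlds M \<and> sat M ((\<lambda>_. w)(x := w, y := v)) \<phi>"

definition bisimulation :: "'p set \<Rightarrow> 'a set \<Rightarrow>
    ('w, 'p, 'a) kripke \<Rightarrow> ('v, 'p, 'a) kripke \<Rightarrow> ('w \<times> 'v) set \<Rightarrow> bool" where
  "bisimulation P A M M' Z \<longleftrightarrow> Z \<subseteq> worlds M \<times> worlds M' \<and>
     (\<forall>(w, w')\<in>Z.
        (\<forall>p\<in>P. w \<in> val M p \<longleftrightarrow> w' \<in> val M' p) \<and>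
        (\<forall>a\<in>A. (\<forall>v. (w, v) \<in> acc M a \<longrightarrow> (\<exists>v'. (w', v') \<in> acc M' a \<and> (v, v') \<in> Z)) \<and>
                (\<forall>v'. (w', v') \<in> acc M' a \<longrightarrow> (\<exists>v. (w, v) \<in> acc M a \<and> (v, v') \<in> Z))))"

definition safe_along :: "('w, 'p, 'a) kripke \<Rightarrow> ('v, 'p, 'a) kripke \<Rightarrow> ('w \<times> 'v) set \<Rightarrow>
    nat \<Rightarrow> nat \<Rightarrow> ('p, 'a) fm \<Rightarrow> bool" where
  "safe_along M M' Z x y \<phi> \<longleftrightarrow>
     (\<forall>(w, w')\<in>Z.
        (\<forall>v. sat2 M x y \<phi> w v \<longrightarrow> (\<exists>v'. sat2 M' x y \<phi> w' v' \<and> (v, v') \<in> Z)) \<and>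
        (\<forall>v'. sat2 M' x y \<phi> w' v' \<longrightarrow> (\<exists>v. sat2 M x y \<phi> w v \<and> (v, v') \<in> Z)))"

text \<open>
  HOL cannot quantify over types inside a formula, so the finite structures are those whose domain
  is a finite set of natural numbers. Every finite structure is isomorphic to one of these;
  \<open>safe_finite_any\<close> and \<open>equiv_finite_any\<close> below show that nothing is lost.
\<close>

definition safe_finite ::
  "'p set \<Rightarrow> 'a set \<Rightarrow> nat \<Rightarrow> nat \<Rightarrow> ('p, 'a) fm \<Rightarrow> bool" where
  "safe_finite P A x y \<phi> \<longleftrightarrow>
     (\<forall>(M :: (nat, 'p, 'a) kripke) (M' :: (nat, 'p, 'a) kripke) Z.
        finite_model P A M \<longrightarrow> finite_model P A M' \<longrightarrow> bisimulation P A M M' Z \<longrightarrow>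
        safe_along M M' Z x y \<phi>)"

definition equiv_finite :: "'p set \<Rightarrow> 'a set \<Rightarrow> ('p, 'a) fm \<Rightarrow> ('p, 'a) fm \<Rightarrow> bool" where
  "equiv_finite P A \<phi> \<psi> \<longleftrightarrow>
     (\<forall>(M :: (nat, 'p, 'a) kripke) s.
        finite_model P A M \<longrightarrow> range s \<subseteq> worlds M \<longrightarrow> (sat M s \<phi> \<longleftrightarrow> sat M s \<psi>))"

datatype (prog_preds: 'p, prog_rels: 'a) prog =
    Test 'p
  | Atom 'a
  | Seq "('p, 'a) prog" "('p, 'a) prog"
  | Choice "('p, 'a) prog" "('p, 'a) prog"
  | Tilde "('p, 'a) prog"

definition program_over :: "'p set \<Rightarrow> 'a set \<Rightarrow> ('p, 'a) prog \<Rightarrow> bool" where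
  "program_over P A \<pi> \<longleftrightarrow> prog_preds \<pi> \<subseteq> P \<and> prog_rels \<pi> \<subseteq> A"

text \<open>
  The free variables of \<open>ST x y \<pi>\<close> are among \<open>x\<close> and \<open>y\<close>, so a bound variable different from these
  two is fresh.
\<close>

definition fresh :: "nat \<Rightarrow> nat \<Rightarrow> nat" where
  "fresh x y = Suc (max x y)"

primrec ST :: "nat \<Rightarrow> nat \<Rightarrow> ('p, 'a) prog \<Rightarrow> ('p, 'a) fm" where
  "ST x y (Test p) = FConj (FEq x y) (FPred p x)"
| "ST x y (Atom a) = FRel a x y"
| "ST x y (Seq \<pi> \<pi>') =
     FEx (fresh x y) (FConj (ST x (fresh x y) \<pi>) (ST (fresh x y) y \<pi>'))"
| "ST x y (Choice \<pi> \<pi>') = FDisj (ST x y \<pi>) (ST x y \<pi>')"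
| "ST x y (Tilde \<pi>) = FConj (FEq x y) (FNeg (FEx (fresh x y) (ST x (fresh x y) \<pi>)))"

lemma fv_ST: "fv (ST x y \<pi>) \<subseteq> {x, y}"
  by (induction \<pi> arbitrary: x y) fastforce+

lemma sat_cong: "(\<And>z. z \<in> fv \<phi> \<Longrightarrow> s z = t z) \<Longrightarrow> sat M s \<phi> \<longleftrightarrow> sat M t \<phi>"
proof (induction \<phi> arbitrary: s t)
  case (FEx z \<phi>)
  have "sat M (s(z := u)) \<phi> \<longleftrightarrow> sat M (t(z := u)) \<phi>" for u
    by (rule FEx.IH) (use FEx.prems in auto)
  then show ?case by simp
next
  case (FAll z \<phi>)
  have "sat M (s(z := u)) \<phi> \<longleftrightarrow> sat M (t(z := u)) \<phi>" for u
    by (rule FAll.IH) (use FAll.prems in auto)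
  then show ?case by simp
next
  case (FNeg \<phi>)
  then have "sat M s \<phi> \<longleftrightarrow> sat M t \<phi>" by (metis fv.simps(4))
  then show ?case by simp
next
  case (FConj \<phi> \<psi>)
  then have "sat M s \<phi> \<longleftrightarrow> sat M t \<phi>" "sat M s \<psi> \<longleftrightarrow> sat M t \<psi>"
    by (metis UnI1 UnI2 fv.simps(5))+
  then show ?case by simp
next
  case (FDisj \<phi> \<psi>)
  then have "sat M s \<phi> \<longleftrightarrow> sat M t \<phi>" "sat M s \<psi> \<longleftrightarrow> sat M t \<psi>"
    by (metis UnI1 UnI2 fv.simps(6))+
  then show ?case by simp
qed auto

definition rename_model :: "('w \<Rightarrow> 'v) \<Rightarrow> ('w, 'p, 'a) kripke \<Rightarrow> ('v, 'p, 'a) kripke" where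
  "rename_model f M = \<lparr>worlds = f ` worlds M, val = \<lambda>p. f ` (val M p \<inter> worlds M),
     acc = \<lambda>a. map_prod f f ` (acc M a \<inter> worlds M \<times> worlds M)\<rparr>"

lemma finite_model_rename: "finite_model P A M \<Longrightarrow> finite_model P A (rename_model f M)"
  by (auto simp: finite_model_def rename_model_def)

lemma sat_rename:
  assumes "inj_on f (worlds M)" and "range s \<subseteq> worlds M"
  shows "sat (rename_model f M) (f \<circ> s) \<phi> \<longleftrightarrow> sat M s \<phi>"
  using assms(2)
proof (induction \<phi> arbitrary: s)
  case (FEq x y)
  then have "s x \<in> worlds M" "s y \<in> worlds M" by auto
  then show ?case using assms(1) by (auto simp: inj_on_def)
next
  case (FPred p x)
  then have "s x \<in> worlds M" by auto
  then show ?case using assms(1) by (auto simp: inj_on_def rename_model_def)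
next
  case (FRel a x y)
  then have s: "s x \<in> worlds M" "s y \<in> worlds M" by auto
  show ?case
  proof
    assume "sat (rename_model f M) (f \<circ> s) (FRel a x y)"
    then obtain u v where "f (s x) = f u" "f (s y) = f v" "(u, v) \<in> acc M a"
      "u \<in> worlds M" "v \<in> worlds M"
      by (auto simp: rename_model_def)
    moreover from this have "s x = u" "s y = v" using assms(1) s by (simp_all add: inj_on_def)
    ultimately show "sat M s (FRel a x y)" by simp
  next
    assume "sat M s (FRel a x y)"
    then have "(s x, s y) \<in> acc M a \<inter> worlds M \<times> worlds M" using s by simp
    then have "map_prod f f (s x, s y) \<in> acc (rename_model f M) a"
      unfolding rename_model_def kripke.simps by (rule imageI)
    then show "sat (rename_model f M) (f \<circ> s) (FRel a x y)" by simp
  qed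
next
  case (FEx z \<phi>)
  have "sat (rename_model f M) ((f \<circ> s)(z := f u)) \<phi> \<longleftrightarrow> sat M (s(z := u)) \<phi>"
    if "u \<in> worlds M" for u
  proof -
    have "(f \<circ> s)(z := f u) = f \<circ> s(z := u)" by auto
    moreover have "range (s(z := u)) \<subseteq> worlds M" using that FEx.prems by auto
    ultimately show ?thesis using FEx.IH by metis
  qed
  moreover have "worlds (rename_model f M) = f ` worlds M" by (simp add: rename_model_def)
  ultimately show ?case by (simp only: sat.simps bex_simps cong: bex_cong)
next
  case (FAll z \<phi>)
  have "sat (rename_model f M) ((f \<circ> s)(z := f u)) \<phi> \<longleftrightarrow> sat M (s(z := u)) \<phi>"
    if "u \<in> worlds M" for u
  proof -
    have "(f \<circ> s)(z := f u) = f \<circ> s(z := u)" by auto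
    moreover have "range (s(z := u)) \<subseteq> worlds M" using that FAll.prems by auto
    ultimately show ?thesis using FAll.IH by metis
  qed
  moreover have "worlds (rename_model f M) = f ` worlds M" by (simp add: rename_model_def)
  ultimately show ?case by (simp only: sat.simps ball_simps cong: ball_cong)
qed simp_all

lemma sat2_rename:
  assumes "inj_on f (worlds M)" and "w \<in> worlds M" and "v \<in> worlds M"
  shows "sat2 (rename_model f M) x y \<phi> (f w) (f v) \<longleftrightarrow> sat2 M x y \<phi> w v"
proof -
  have "(\<lambda>_. f w)(x := f w, y := f v) = f \<circ> (\<lambda>_. w)(x := w, y := v)" by auto
  moreover have "range ((\<lambda>_. w)(x := w, y := v)) \<subseteq> worlds M" using assms by auto
  ultimately have "sat (rename_model f M) ((\<lambda>_. f w)(x := f w, y := f v)) \<phi> \<longleftrightarrow>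
      sat M ((\<lambda>_. w)(x := w, y := v)) \<phi>"
    using sat_rename[OF assms(1)] by metis
  moreover have "f w \<in> worlds (rename_model f M)" "f v \<in> worlds (rename_model f M)"
    using assms by (auto simp: rename_model_def)
  ultimately show ?thesis using assms by (simp add: sat2_def)
qed

lemma equiv_finite_any:
  fixes M :: "('w, 'p, 'a) kripke"
  assumes "equiv_finite P A \<phi> \<psi>" and "finite_model P A M" and "range s \<subseteq> worlds M"
  shows "sat M s \<phi> \<longleftrightarrow> sat M s \<psi>"
proof -
  obtain f :: "'w \<Rightarrow> nat" where f: "inj_on f (worlds M)"
    using assms(2) finite_imp_inj_to_nat_seg unfolding finite_model_def by metis
  have "range (f \<circ> s) \<subseteq> worlds (rename_model f M)"
    using assms(3) by (auto simp: rename_model_def)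
  then show ?thesis
    using assms finite_model_rename[OF assms(2), of f] sat_rename[OF f assms(3)]
    unfolding equiv_finite_def by metis
qed

lemma acc_rename:
  assumes f: "inj_on f (worlds M)" and w: "w \<in> worlds M"
    and sub: "acc M a \<subseteq> worlds M \<times> worlds M"
  shows "(f w, u) \<in> acc (rename_model f M) a \<longleftrightarrow> (\<exists>v. u = f v \<and> (w, v) \<in> acc M a)"
proof
  assume "(f w, u) \<in> acc (rename_model f M) a"
  then obtain w0 v where *: "f w = f w0" "u = f v" "(w0, v) \<in> acc M a" "w0 \<in> worlds M"
    by (auto simp: rename_model_def)
  then have "w = w0" using f w by (simp add: inj_on_def)
  then show "\<exists>v. u = f v \<and> (w, v) \<in> acc M a" using * by blast
next
  assume "\<exists>v. u = f v \<and> (w, v) \<in> acc M a"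
  then obtain v where v: "u = f v" "(w, v) \<in> acc M a" by blast
  then have "(w, v) \<in> acc M a \<inter> worlds M \<times> worlds M" using sub by blast
  then have "map_prod f f (w, v) \<in> acc (rename_model f M) a"
    unfolding rename_model_def kripke.simps by (rule imageI)
  then show "(f w, u) \<in> acc (rename_model f M) a" using v by simp
qed

lemma bisimulation_rename:
  assumes Z: "bisimulation P A M M' Z"
    and M: "finite_model P A M" and M': "finite_model P A M'"
    and f: "inj_on f (worlds M)" and g: "inj_on g (worlds M')"
  shows "bisimulation P A (rename_model f M) (rename_model g M') (map_prod f g ` Z)"
proof -
  have sub: "Z \<subseteq> worlds M \<times> worlds M'" using Z by (simp add: bisimulation_def)
  have val_f: "f w \<in> val (rename_model f M) p \<longleftrightarrow> w \<in> val M p" if "w \<in> worlds M" for w p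
    using that f by (auto simp: rename_model_def inj_on_def image_iff)
  have val_g: "g w \<in> val (rename_model g M') p \<longleftrightarrow> w \<in> val M' p" if "w \<in> worlds M'" for w p
    using that g by (auto simp: rename_model_def inj_on_def image_iff)
  have acc_f: "(f w, u) \<in> acc (rename_model f M) a \<longleftrightarrow> (\<exists>v. u = f v \<and> (w, v) \<in> acc M a)"
    if "w \<in> worlds M" "a \<in> A" for w u a
    using M that by (intro acc_rename[OF f]) (auto simp: finite_model_def)
  have acc_g: "(g w, u) \<in> acc (rename_model g M') a \<longleftrightarrow> (\<exists>v. u = g v \<and> (w, v) \<in> acc M' a)"
    if "w \<in> worlds M'" "a \<in> A" for w u a
    using M' that by (intro acc_rename[OF g]) (auto simp: finite_model_def)
  have "(\<forall>p\<in>P. f w \<in> val (rename_model f M) p \<longleftrightarrow> g w' \<in> val (rename_model g M') p) \<and>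
      (\<forall>a\<in>A. (\<forall>v. (f w, v) \<in> acc (rename_model f M) a \<longrightarrow>
                (\<exists>v'. (g w', v') \<in> acc (rename_model g M') a \<and> (v, v') \<in> map_prod f g ` Z)) \<and>
             (\<forall>v'. (g w', v') \<in> acc (rename_model g M') a \<longrightarrow>
                (\<exists>v. (f w, v) \<in> acc (rename_model f M) a \<and> (v, v') \<in> map_prod f g ` Z)))"
    if "(w, w') \<in> Z" for w w'
  proof -
    have w: "w \<in> worlds M" "w' \<in> worlds M'" using sub that by auto
    have Zw: "(\<forall>p\<in>P. w \<in> val M p \<longleftrightarrow> w' \<in> val M' p) \<and>
        (\<forall>a\<in>A. (\<forall>v. (w, v) \<in> acc M a \<longrightarrow> (\<exists>v'. (w', v') \<in> acc M' a \<and> (v, v') \<in> Z)) \<and>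
                (\<forall>v'. (w', v') \<in> acc M' a \<longrightarrow> (\<exists>v. (w, v) \<in> acc M a \<and> (v, v') \<in> Z)))"
      using bspec[OF conjunct2[OF Z[unfolded bisimulation_def]] that] by simp
    have im: "(v, v') \<in> Z \<Longrightarrow> (f v, g v') \<in> map_prod f g ` Z" for v v' by force
    show ?thesis
    proof (intro conjI ballI allI impI)
      fix p assume "p \<in> P"
      then show "f w \<in> val (rename_model f M) p \<longleftrightarrow> g w' \<in> val (rename_model g M') p"
        using Zw w by (simp add: val_f val_g)
    next
      fix a v assume a: "a \<in> A" and "(f w, v) \<in> acc (rename_model f M) a"
      then obtain u where u: "v = f u" "(w, u) \<in> acc M a" using acc_f w by blast
      then obtain u' where "(w', u') \<in> acc M' a" "(u, u') \<in> Z" using Zw a by blast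
      then show "\<exists>v'. (g w', v') \<in> acc (rename_model g M') a \<and> (v, v') \<in> map_prod f g ` Z"
        using u acc_g[OF w(2) a] im by blast
    next
      fix a v' assume a: "a \<in> A" and "(g w', v') \<in> acc (rename_model g M') a"
      then obtain u' where u': "v' = g u'" "(w', u') \<in> acc M' a" using acc_g w by blast
      then obtain u where "(w, u) \<in> acc M a" "(u, u') \<in> Z" using Zw a by blast
      then show "\<exists>v. (f w, v) \<in> acc (rename_model f M) a \<and> (v, v') \<in> map_prod f g ` Z"
        using u' acc_f[OF w(1) a] im by blast
    qed
  qed
  moreover have "map_prod f g ` Z \<subseteq> worlds (rename_model f M) \<times> worlds (rename_model g M')"
    using sub by (auto simp: rename_model_def)
  ultimately show ?thesis unfolding bisimulation_def by auto
qed

lemma safe_finite_any: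
  fixes M :: "('w, 'p, 'a) kripke" and M' :: "('v, 'p, 'a) kripke"
  assumes safe: "safe_finite P A x y \<phi>"
    and M: "finite_model P A M" and M': "finite_model P A M'"
    and Z: "bisimulation P A M M' Z"
  shows "safe_along M M' Z x y \<phi>"
proof -
  obtain f :: "'w \<Rightarrow> nat" where f: "inj_on f (worlds M)"
    using M finite_imp_inj_to_nat_seg unfolding finite_model_def by metis
  obtain g :: "'v \<Rightarrow> nat" where g: "inj_on g (worlds M')"
    using M' finite_imp_inj_to_nat_seg unfolding finite_model_def by metis
  let ?N = "rename_model f M" and ?N' = "rename_model g M'" and ?Y = "map_prod f g ` Z"
  have along: "safe_along ?N ?N' ?Y x y \<phi>"
    using safe finite_model_rename[OF M] finite_model_rename[OF M']
      bisimulation_rename[OF Z M M' f g]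
    unfolding safe_finite_def by metis
  have sub: "Z \<subseteq> worlds M \<times> worlds M'" using Z by (simp add: bisimulation_def)
  have pull: "(v, v') \<in> Z" if "(f v, g v') \<in> ?Y" "v \<in> worlds M" "v' \<in> worlds M'" for v v'
  proof -
    obtain u u' where u: "f v = f u" "g v' = g u'" "(u, u') \<in> Z" using \<open>(f v, g v') \<in> ?Y\<close> by auto
    then have "u \<in> worlds M" "u' \<in> worlds M'" using sub by auto
    then have "v = u" "v' = u'" using u that f g by (simp_all add: inj_on_def)
    then show ?thesis using u by simp
  qed
  show ?thesis
    unfolding safe_along_def
  proof (intro ballI, clarify, intro conjI allI impI)
    fix w w' v assume w: "(w, w') \<in> Z" and v: "sat2 M x y \<phi> w v"
    have "(f w, g w') \<in> ?Y" using w by force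
    moreover have "w \<in> worlds M" "v \<in> worlds M" "w' \<in> worlds M'"
      using w v sub by (auto simp: sat2_def)
    moreover from this v have "sat2 ?N x y \<phi> (f w) (f v)" using sat2_rename[OF f] by metis
    ultimately obtain u where u: "sat2 ?N' x y \<phi> (g w') u" "(f v, u) \<in> ?Y"
      using along[unfolded safe_along_def, THEN bspec, of "(f w, g w')"]
      unfolding prod.case by metis
    then obtain v' where "u = g v'" "v' \<in> worlds M'"
      by (auto simp: sat2_def rename_model_def)
    then show "\<exists>v'. sat2 M' x y \<phi> w' v' \<and> (v, v') \<in> Z"
      using u pull sat2_rename[OF g] \<open>v \<in> worlds M\<close> \<open>w' \<in> worlds M'\<close> by metis
  next
    fix w w' v' assume w: "(w, w') \<in> Z" and v: "sat2 M' x y \<phi> w' v'"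
    have "(f w, g w') \<in> ?Y" using w by force
    moreover have "w \<in> worlds M" "v' \<in> worlds M'" "w' \<in> worlds M'"
      using w v sub by (auto simp: sat2_def)
    moreover from this v have "sat2 ?N' x y \<phi> (g w') (g v')" using sat2_rename[OF g] by metis
    ultimately obtain u where u: "sat2 ?N x y \<phi> (f w) u" "(u, g v') \<in> ?Y"
      using along[unfolded safe_along_def, THEN bspec, of "(f w, g w')"]
      unfolding prod.case by metis
    then obtain v where "u = f v" "v \<in> worlds M"
      by (auto simp: sat2_def rename_model_def)
    then show "\<exists>v. sat2 M x y \<phi> w v \<and> (v, v') \<in> Z"
      using u pull sat2_rename[OF f] \<open>w \<in> worlds M\<close> \<open>v' \<in> worlds M'\<close> by metis
  qed
qed

text \<open>
  The grammar has no constant programs, so over the empty signature there is no program at all,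
  although \<open>x = y\<close> is safe; hence the results need a nonempty signature.
\<close>

lemma no_program_over_empty: "\<not> program_over {} {} \<pi>"
  by (induction \<pi>) (auto simp: program_over_def)

lemma safe_finite_FEq: "x \<noteq> y \<Longrightarrow> safe_finite P A x y (FEq x y)"
  by (auto simp: safe_finite_def safe_along_def sat2_def bisimulation_def)

end

theory Submission
  imports Defs
begin

text \<open>
  Programs are safe by induction. For the converse let \<open>\<phi>\<close> be safe, of quantifier rank \<open>q\<close>, and put
  \<open>r = 2 ^ (q + 1)\<close>. Replace a finite model \<open>M\<close> with a point \<open>w\<close> by its unravelling from \<open>w\<close> to
  depth \<open>r\<close>, followed by a copy of \<open>M\<close>; this is bisimilar to \<open>M\<close> and again finite. An
  Ehrenfeucht-Fraisse game on disjoint unions with many spare copies of the unravelling and of its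
  tree part shows that cutting off everything below depth \<open>r\<close> does not change which \<open>v\<close> satisfy
  \<open>\<phi>(w, v)\<close>: safety makes \<open>\<phi>\<close> blind to the spare copies and forces \<open>v\<close> to be in the component of
  \<open>w\<close>. In particular \<open>v\<close> lies in the tree, at the end of a unique branch. Two trees whose
  distinguished branches carry the same labels and the same types of bounded modal depth are related
  by a bisimulation that matches these branches only with each other, so by safety the truth of
  \<open>\<phi>(w, v)\<close> depends only on the sequence of labels and types along the branch. There are finitely
  many such sequences, each is expressed by a program, and \<open>\<phi>\<close> is the union of the programs of
  those sequences that enforce it.
\<close>

section \<open>Safety, bisimulations and satisfaction in directly applicable form\<close>

lemma safe_finite_forth:
  assumes "safe_finite P A x y \<phi>" "finite_model P A M" "finite_model P A M'"
    "bisimulation P A M M' Z" "(w, w') \<in> Z" "sat2 M x y \<phi> w v"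
  shows "\<exists>v'. sat2 M' x y \<phi> w' v' \<and> (v, v') \<in> Z"
  using safe_finite_any[OF assms(1-4)] assms(5,6) unfolding safe_along_def by fast

lemma safe_finite_back:
  assumes "safe_finite P A x y \<phi>" "finite_model P A M" "finite_model P A M'"
    "bisimulation P A M M' Z" "(w, w') \<in> Z" "sat2 M' x y \<phi> w' v'"
  shows "\<exists>v. sat2 M x y \<phi> w v \<and> (v, v') \<in> Z"
  using safe_finite_any[OF assms(1-4)] assms(5,6) unfolding safe_along_def by fast

lemma bisimulationI:
  assumes "\<And>w w'. (w, w') \<in> Z \<Longrightarrow> w \<in> worlds M \<and> w' \<in> worlds M'"
    and "\<And>w w' p. (w, w') \<in> Z \<Longrightarrow> p \<in> P \<Longrightarrow> w \<in> val M p \<longleftrightarrow> w' \<in> val M' p"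
    and "\<And>w w' a v. (w, w') \<in> Z \<Longrightarrow> a \<in> A \<Longrightarrow> (w, v) \<in> acc M a \<Longrightarrow>
      \<exists>v'. (w', v') \<in> acc M' a \<and> (v, v') \<in> Z"
    and "\<And>w w' a v'. (w, w') \<in> Z \<Longrightarrow> a \<in> A \<Longrightarrow> (w', v') \<in> acc M' a \<Longrightarrow>
      \<exists>v. (w, v) \<in> acc M a \<and> (v, v') \<in> Z"
  shows "bisimulation P A M M' Z"
  unfolding bisimulation_def using assms by fast

lemma sat_iff_sat2:
  assumes "fv \<phi> \<subseteq> {x, y}" "range s \<subseteq> worlds M"
  shows "sat M s \<phi> \<longleftrightarrow> sat2 M x y \<phi> (s x) (s y)"
proof -
  have "sat M s \<phi> \<longleftrightarrow> sat M ((\<lambda>_. s x)(x := s x, y := s y)) \<phi>"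
    by (rule sat_cong) (use assms(1) in auto)
  then show ?thesis using assms(2) by (auto simp: sat2_def)
qed


section \<open>Relational semantics of programs\<close>

text \<open>Intermediate points are confined to \<open>worlds M\<close>, just as the quantifiers of
  \<open>ST\<close> are, so \<open>sat_ST\<close> holds in every structure.\<close>

primrec runs :: "('w, 'p, 'a) kripke \<Rightarrow> ('p, 'a) prog \<Rightarrow> 'w \<Rightarrow> 'w \<Rightarrow> bool" where
  "runs M (Test p) u v \<longleftrightarrow> u = v \<and> u \<in> val M p"
| "runs M (Atom a) u v \<longleftrightarrow> (u, v) \<in> acc M a"
| "runs M (Seq \<pi> \<pi>') u v \<longleftrightarrow> (\<exists>z\<in>worlds M. runs M \<pi> u z \<and> runs M \<pi>' z v)"
| "runs M (Choice \<pi> \<pi>') u v \<longleftrightarrow> runs M \<pi> u v \<or> runs M \<pi>' u v"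
| "runs M (Tilde \<pi>) u v \<longleftrightarrow> u = v \<and> \<not> (\<exists>z\<in>worlds M. runs M \<pi> u z)"

lemma sat_ST: "sat M s (ST x y \<pi>) \<longleftrightarrow> runs M \<pi> (s x) (s y)"
proof (induction \<pi> arbitrary: x y s)
  case (Seq \<pi> \<pi>')
  have "x \<noteq> fresh x y" "y \<noteq> fresh x y" by (auto simp: fresh_def)
  then show ?case using Seq by simp
next
  case (Tilde \<pi>)
  have "x \<noteq> fresh x y" by (auto simp: fresh_def)
  then show ?case using Tilde by simp
qed auto

text \<open>Both directions go through one induction because \<open>Tilde\<close> swaps them: a
  forth step for \<open>Tilde \<pi>\<close> excludes runs of \<open>\<pi>\<close> in
  \<open>M'\<close> by pulling them back to \<open>M\<close>.\<close>

lemma runs_bisimulation: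
  assumes "bisimulation P A M M' Z" "program_over P A \<pi>" "(w, w') \<in> Z"
  shows "(\<forall>v\<in>worlds M. runs M \<pi> w v \<longrightarrow> (\<exists>v'. runs M' \<pi> w' v' \<and> (v, v') \<in> Z)) \<and>
    (\<forall>v'\<in>worlds M'. runs M' \<pi> w' v' \<longrightarrow> (\<exists>v. runs M \<pi> w v \<and> (v, v') \<in> Z))"
  using assms(2,3)
proof (induction \<pi> arbitrary: w w')
  case (Test p)
  then show ?case using assms(1) by (fastforce simp: bisimulation_def program_over_def)
next
  case (Atom a)
  then show ?case using assms(1) by (fastforce simp: bisimulation_def program_over_def)
next
  case (Seq \<pi> \<pi>')
  have Z: "Z \<subseteq> worlds M \<times> worlds M'" using assms(1) by (simp add: bisimulation_def)
  have p: "program_over P A \<pi>" "program_over P A \<pi>'" using Seq.prems by (auto simp: program_over_def)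
  show ?case
  proof (intro conjI ballI impI)
    fix v assume v: "v \<in> worlds M" "runs M (Seq \<pi> \<pi>') w v"
    then obtain z where z: "z \<in> worlds M" "runs M \<pi> w z" "runs M \<pi>' z v" by auto
    then obtain z' where z': "runs M' \<pi> w' z'" "(z, z') \<in> Z"
      using Seq.IH(1)[OF p(1) Seq.prems(2)] by blast
    then obtain v' where "runs M' \<pi>' z' v'" "(v, v') \<in> Z"
      using Seq.IH(2)[OF p(2) z'(2)] z v by blast
    then show "\<exists>v'. runs M' (Seq \<pi> \<pi>') w' v' \<and> (v, v') \<in> Z" using z' Z by auto
  next
    fix v' assume v: "v' \<in> worlds M'" "runs M' (Seq \<pi> \<pi>') w' v'"
    then obtain z' where z: "z' \<in> worlds M'" "runs M' \<pi> w' z'" "runs M' \<pi>' z' v'" by auto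
    then obtain z where z': "runs M \<pi> w z" "(z, z') \<in> Z"
      using Seq.IH(1)[OF p(1) Seq.prems(2)] by blast
    then obtain v where "runs M \<pi>' z v" "(v, v') \<in> Z"
      using Seq.IH(2)[OF p(2) z'(2)] z v by blast
    then show "\<exists>v. runs M (Seq \<pi> \<pi>') w v \<and> (v, v') \<in> Z" using z' Z by auto
  qed
next
  case (Choice \<pi> \<pi>')
  have p: "program_over P A \<pi>" "program_over P A \<pi>'"
    using Choice.prems by (auto simp: program_over_def)
  show ?case
    using Choice.IH(1)[OF p(1) Choice.prems(2)] Choice.IH(2)[OF p(2) Choice.prems(2)]
    unfolding runs.simps by blast
next
  case (Tilde \<pi>)
  have Z: "Z \<subseteq> worlds M \<times> worlds M'" using assms(1) by (simp add: bisimulation_def)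
  have p: "program_over P A \<pi>" using Tilde.prems by (auto simp: program_over_def)
  show ?case using Tilde.IH[OF p Tilde.prems(2)] Tilde.prems(2) Z
    unfolding runs.simps by blast
qed

lemma safe_finite_program:
  assumes "program_over P A \<pi>" "equiv_finite P A \<phi> (ST x y \<pi>)" "x \<noteq> y"
  shows "safe_finite P A x y \<phi>"
  unfolding safe_finite_def
proof (intro allI impI)
  fix M M' :: "(nat, 'a, 'b) kripke" and Z
  assume M: "finite_model P A M" and M': "finite_model P A M'" and Z: "bisimulation P A M M' Z"
  have sub: "Z \<subseteq> worlds M \<times> worlds M'" using Z by (simp add: bisimulation_def)
  have sat2: "sat2 N x y \<phi> w v \<longleftrightarrow> w \<in> worlds N \<and> v \<in> worlds N \<and> runs N \<pi> w v"
    if N: "finite_model P A N" for N :: "(nat, 'a, 'b) kripke" and w v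
  proof (cases "w \<in> worlds N \<and> v \<in> worlds N")
    case True
    then have "range ((\<lambda>_. w)(x := w, y := v)) \<subseteq> worlds N" by auto
    then have "sat N ((\<lambda>_. w)(x := w, y := v)) \<phi> \<longleftrightarrow> sat N ((\<lambda>_. w)(x := w, y := v)) (ST x y \<pi>)"
      using assms(2) N unfolding equiv_finite_def by blast
    then show ?thesis using True assms(3) by (simp add: sat2_def sat_ST)
  qed (auto simp: sat2_def)
  show "safe_along M M' Z x y \<phi>"
    unfolding safe_along_def sat2[OF M] sat2[OF M']
    using runs_bisimulation[OF Z assms(1)] sub by fast
qed


section \<open>Reduction to a finite signature\<close>

text \<open>Symbols outside the small signature are emptied, which makes its models and
  bisimulations into models and bisimulations of the large signature.\<close>

definition cut_signature :: "'p set \<Rightarrow> 'a set \<Rightarrow> ('w, 'p, 'a) kripke \<Rightarrow> ('w, 'p, 'a) kripke" where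
  "cut_signature P A M = \<lparr>worlds = worlds M, val = \<lambda>p. if p \<in> P then val M p else {},
     acc = \<lambda>a. if a \<in> A then acc M a else {}\<rparr>"

lemma sat_cut_signature:
  "formula_over P A \<phi> \<Longrightarrow> sat (cut_signature P A M) s \<phi> \<longleftrightarrow> sat M s \<phi>"
  by (induction \<phi> arbitrary: s) (auto simp: formula_over_def cut_signature_def)

text \<open>Passing to the finitely many relevant symbols keeps unravellings finite and leaves only
  finitely many types of each depth.\<close>

lemma safe_finite_subsignature:
  assumes safe: "safe_finite P A x y \<phi>" and sub: "Q \<subseteq> P" "B \<subseteq> A" and \<phi>: "formula_over Q B \<phi>"
  shows "safe_finite Q B x y \<phi>"
  unfolding safe_finite_def
proof (intro allI impI)
  fix M M' :: "(nat, 'a, 'b) kripke" and Z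
  assume M: "finite_model Q B M" and M': "finite_model Q B M'" and Z: "bisimulation Q B M M' Z"
  have fin: "finite_model P A (cut_signature Q B N)" if "finite_model Q B N"
    for N :: "(nat, 'a, 'b) kripke"
    using that by (auto simp: finite_model_def cut_signature_def)
  have "bisimulation P A (cut_signature Q B M) (cut_signature Q B M') Z"
    using Z by (auto simp: bisimulation_def cut_signature_def)
  then have "safe_along (cut_signature Q B M) (cut_signature Q B M') Z x y \<phi>"
    using safe fin M M' unfolding safe_finite_def by blast
  moreover have "sat2 (cut_signature Q B N) x y \<phi> w v \<longleftrightarrow> sat2 N x y \<phi> w v"
    for N :: "(nat, 'a, 'b) kripke" and w v
    unfolding sat2_def sat_cut_signature[OF \<phi>] by (simp add: cut_signature_def)
  ultimately show "safe_along M M' Z x y \<phi>" by (simp add: safe_along_def)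
qed

lemma finite_fm_preds: "finite (fm_preds \<phi>)"
  by (induction \<phi>) auto

lemma finite_fm_rels: "finite (fm_rels \<phi>)"
  by (induction \<phi>) auto


section \<open>Locality\<close>

primrec qrank :: "('p, 'a) fm \<Rightarrow> nat" where
  "qrank (FEq x y) = 0"
| "qrank (FPred p x) = 0"
| "qrank (FRel a x y) = 0"
| "qrank (FNeg \<phi>) = qrank \<phi>"
| "qrank (FConj \<phi> \<psi>) = max (qrank \<phi>) (qrank \<psi>)"
| "qrank (FDisj \<phi> \<psi>) = max (qrank \<phi>) (qrank \<psi>)"
| "qrank (FEx z \<phi>) = Suc (qrank \<phi>)"
| "qrank (FAll z \<phi>) = Suc (qrank \<phi>)"

section \<open>Submodels and disjoint unions of submodels\<close>

definition restrict_model :: "'w set \<Rightarrow> ('w, 'p, 'a) kripke \<Rightarrow> ('w, 'p, 'a) kripke" where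
  "restrict_model X M = \<lparr>worlds = worlds M \<inter> X, val = \<lambda>p. val M p \<inter> X,
     acc = \<lambda>a. acc M a \<inter> X \<times> X\<rparr>"

definition copies :: "nat \<Rightarrow> (nat \<Rightarrow> 'w set) \<Rightarrow> ('w, 'p, 'a) kripke \<Rightarrow> (nat \<times> 'w, 'p, 'a) kripke" where
  "copies n X M = \<lparr>worlds = {(c, u). c < n \<and> u \<in> worlds M \<inter> X c},
     val = \<lambda>p. {(c, u). c < n \<and> u \<in> val M p \<inter> X c},
     acc = \<lambda>a. {((c, u), (d, v)). c = d \<and> c < n \<and> u \<in> X c \<and> v \<in> X c \<and> (u, v) \<in> acc M a}\<rparr>"

lemma finite_model_restrict:
  "finite_model P A M \<Longrightarrow> w \<in> worlds M \<Longrightarrow> w \<in> X \<Longrightarrow> finite_model P A (restrict_model X M)"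
  by (auto simp: finite_model_def restrict_model_def)

lemma finite_model_copies:
  assumes "finite_model P A M" "w \<in> worlds M" "w \<in> X c" "c < n"
  shows "finite_model P A (copies n X M)"
proof -
  have "worlds (copies n X M) \<subseteq> {..<n} \<times> worlds M" by (auto simp: copies_def)
  then have "finite (worlds (copies n X M))"
    by (rule finite_subset) (use assms(1) in \<open>simp add: finite_model_def\<close>)
  moreover have "(c, w) \<in> worlds (copies n X M)" using assms by (auto simp: copies_def)
  ultimately show ?thesis using assms(1) unfolding finite_model_def
    by (fastforce simp: copies_def)
qed

lemma restrict_model_UNIV: "restrict_model UNIV M = M"
  by (simp add: restrict_model_def)

text \<open>The embedding of one component into the disjoint union is a bisimulation whose range is
  that component. Safety along it removes the other components from view and keeps the second
  argument in the component of the first.\<close>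

lemma sat2_copies_iff:
  assumes safe: "safe_finite P A x y \<phi>" and M: "finite_model P A M"
    and w: "w \<in> worlds M" "w \<in> X c" and c: "c < n"
  shows "sat2 (copies n X M) x y \<phi> (c, w) e \<longleftrightarrow>
    (\<exists>v. e = (c, v) \<and> sat2 (restrict_model (X c) M) x y \<phi> w v)"
proof -
  let ?Z = "{(u, (c, u)) |u. u \<in> worlds M \<inter> X c}"
  have Z: "bisimulation P A (restrict_model (X c) M) (copies n X M) ?Z"
    by (rule bisimulationI)
      (use M c in \<open>fastforce simp: restrict_model_def copies_def finite_model_def\<close>)+
  have R: "finite_model P A (restrict_model (X c) M)" using finite_model_restrict[OF M w] .
  have C: "finite_model P A (copies n X M)" using finite_model_copies[of P A M w X c n] M w c by blast
  have wZ: "(w, (c, w)) \<in> ?Z" using w by blast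
  show ?thesis
    using safe_finite_forth[OF safe R C Z wZ] safe_finite_back[OF safe R C Z wZ] by blast
qed

section \<open>Distance and the Ehrenfeucht-Fraisse game in layered models\<close>

locale layered_model =
  fixes P :: "'p set" and A :: "'a set" and M :: "('w, 'p, 'a) kripke"
    and depth :: "'w \<Rightarrow> nat" and r :: nat
  assumes finite_model: "finite_model P A M"
    and depth_acc: "a \<in> A \<Longrightarrow> (u, v) \<in> acc M a \<Longrightarrow>
      depth u \<le> Suc (depth v) \<and> depth v \<le> Suc (depth u)"
begin

definition inner :: "'w set" where
  "inner = {u. depth u \<le> r}"

text \<open>Adjacency in the Gaifman graph of the submodel on \<open>X\<close>. It is made reflexive
  so that \<open>near X n\<close> means distance at most \<open>n\<close>, not walks of length
  exactly \<open>n\<close>.\<close>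

definition step :: "'w set \<Rightarrow> ('w \<times> 'w) set" where
  "step X = {(u, v). u = v \<or> u \<in> X \<and> v \<in> X \<and> (\<exists>a\<in>A. (u, v) \<in> acc M a \<or> (v, u) \<in> acc M a)}"

definition near :: "'w set \<Rightarrow> nat \<Rightarrow> 'w \<Rightarrow> 'w \<Rightarrow> bool" where
  "near X n u v \<longleftrightarrow> (u, v) \<in> step X ^^ n"

lemma near_Suc: "near X (Suc n) u v \<longleftrightarrow> (\<exists>z. near X n u z \<and> (z, v) \<in> step X)"
  by (auto simp: near_def)

lemma near_trans: "near X m u v \<Longrightarrow> near X n v z \<Longrightarrow> near X (m + n) u z"
  by (auto simp: near_def relpow_add)

lemma near_refl: "near X n u u"
  by (induction n) (auto simp: near_def step_def)

lemma near_mono: "m \<le> n \<Longrightarrow> near X m u v \<Longrightarrow> near X n u v"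
  using near_trans[of X m u v "n - m" v] near_refl by simp

lemma near_sym: "near X n u v \<Longrightarrow> near X n v u"
proof (induction n arbitrary: v)
  case (Suc n)
  then obtain z where "near X n u z" "(z, v) \<in> step X" by (auto simp: near_Suc)
  then have "near X 1 v z" "near X n z u" using Suc.IH by (auto simp: near_def step_def)
  then show ?case using near_trans by fastforce
qed (simp add: near_def)

text \<open>Each step changes the depth by at most one, so a walk of length \<open>n\<close> from
  \<open>u\<close> never leaves \<open>inner\<close> and is available in every set containing
  it.\<close>

lemma near_inner:
  assumes "near X n u v" "depth u + n \<le> r" "inner \<subseteq> Y"
  shows "near Y n u v \<and> depth v \<le> depth u + n"
  using assms(1,2)
proof (induction n arbitrary: v)
  case (Suc n)
  then obtain z where z: "near X n u z" "(z, v) \<in> step X" by (auto simp: near_Suc)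
  then have IH: "near Y n u z" "depth z \<le> depth u + n" using Suc by auto
  have v: "depth v \<le> Suc (depth z)" using z(2) depth_acc by (fastforce simp: step_def)
  then have "z \<in> Y" "v \<in> Y" using IH(2) Suc.prems(2) assms(3) by (auto simp: inner_def)
  then have "(z, v) \<in> step Y" using z(2) by (auto simp: step_def)
  then show ?case using IH v by (auto simp: near_Suc)
qed (simp add: near_def)

text \<open>Copy 0 is left free and will hold the distinguished point; behind it come
  \<open>m\<close> spare copies of the whole model and \<open>m\<close> of its inner part.\<close>

definition family :: "nat \<Rightarrow> (nat \<Rightarrow> 'w set) \<Rightarrow> bool" where
  "family m X \<longleftrightarrow> (\<forall>c. X c = UNIV \<or> X c = inner) \<and> (\<forall>c. 1 \<le> c \<longrightarrow> c \<le> m \<longrightarrow> X c = UNIV) \<and>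
     (\<forall>c. m < c \<longrightarrow> c \<le> 2 * m \<longrightarrow> X c = inner)"

lemma family_inner: "family m X \<Longrightarrow> inner \<subseteq> X c"
  unfolding family_def by (metis subset_UNIV subset_refl)

lemma family_fresh:
  assumes X: "family m X" and Y: "family m Y" and U: "finite U" "card U < m"
  shows "\<exists>d < Suc (2 * m). d \<notin> U \<and> Y d = X c"
proof -
  have "\<not> {1..m} \<subseteq> U" using card_mono[OF U(1), of "{1..m}"] U(2) by auto
  then obtain d where d: "1 \<le> d" "d \<le> m" "d \<notin> U"
    unfolding subset_iff atLeastAtMost_iff by blast
  have "\<not> {m<..2 * m} \<subseteq> U" using card_mono[OF U(1), of "{m<..2 * m}"] U(2) by auto
  then obtain d' where d': "m < d'" "d' \<le> 2 * m" "d' \<notin> U"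
    unfolding subset_iff greaterThanAtMost_iff by blast
  consider "X c = UNIV" | "X c = inner" using X by (auto simp: family_def)
  then show ?thesis
  proof cases
    case 1
    then show ?thesis using d Y by (intro exI[of _ d]) (auto simp: family_def)
  next
    case 2
    then show ?thesis using d' Y by (intro exI[of _ d']) (auto simp: family_def)
  qed
qed

text \<open>
  The invariant of the duplicator's strategy with \<open>k\<close> rounds left. Corresponding pebbles sit on the
  same world in possibly different copies; unless the two copies agree, the world is so shallow that
  the ball of radius \<open>2 ^ k\<close> around it lies in the inner part. Pebbles at distance at most
  \<open>2 ^ k\<close> are answered in a common copy. The cardinality bounds leave unused copies for the
  remaining rounds.
\<close>

definition game :: "nat \<Rightarrow> (nat \<Rightarrow> 'w set) \<Rightarrow> (nat \<Rightarrow> 'w set) \<Rightarrow> nat \<Rightarrow>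
    (nat \<Rightarrow> nat \<times> 'w) \<Rightarrow> (nat \<Rightarrow> nat \<times> 'w) \<Rightarrow> bool" where
  "game m X Y k s t \<longleftrightarrow>
     range s \<subseteq> worlds (copies (Suc (2 * m)) X M) \<and> range t \<subseteq> worlds (copies (Suc (2 * m)) Y M) \<and>
     (\<forall>i. snd (t i) = snd (s i)) \<and>
     (\<forall>i. X (fst (s i)) = Y (fst (t i)) \<or> depth (snd (s i)) + 2 ^ k \<le> r) \<and>
     (\<forall>i j. fst (s i) = fst (s j) \<longrightarrow> near (X (fst (s i))) (2 ^ k) (snd (s i)) (snd (s j)) \<longrightarrow>
        fst (t i) = fst (t j)) \<and>
     (\<forall>i j. fst (t i) = fst (t j) \<longrightarrow> near (Y (fst (t i))) (2 ^ k) (snd (s i)) (snd (s j)) \<longrightarrow>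
        fst (s i) = fst (s j)) \<and>
     card (fst ` range s) + k \<le> m \<and> card (fst ` range t) + k \<le> m"

lemma game_sym:
  assumes "game m X Y k s t"
  shows "game m Y X k t s"
proof -
  have snd: "snd (t i) = snd (s i)" for i using assms unfolding game_def by blast
  have "Y (fst (t i)) = X (fst (s i)) \<or> depth (snd (s i)) + 2 ^ k \<le> r" for i
    using assms unfolding game_def by metis
  then show ?thesis using assms unfolding game_def snd by blast
qed

lemma card_fst_range_update:
  assumes "finite (fst ` range s)"
  shows "card (fst ` range (s(z := e))) \<le> Suc (card (fst ` range s))"
proof -
  have "fst ` range (s(z := e)) \<subseteq> insert (fst e) (fst ` range s)" by auto
  then have "card (fst ` range (s(z := e))) \<le> card (insert (fst e) (fst ` range s))"
    using assms by (intro card_mono) auto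
  then show ?thesis using assms by (simp add: card_insert_if split: if_splits)
qed

text \<open>Only pairs involving the new pebble need conditions: for old pairs the radius shrinks
  from \<open>2 ^ Suc k\<close> to \<open>2 ^ k\<close>. The new pebble occupies at most one more
  copy, paid for by the round just played.\<close>

lemma game_update:
  assumes g: "game m X Y (Suc k) s t"
    and e: "(c, u) \<in> worlds (copies (Suc (2 * m)) X M)"
    and d: "(d, u) \<in> worlds (copies (Suc (2 * m)) Y M)"
    and loc: "X c = Y d \<or> depth u + 2 ^ k \<le> r"
    and near_s: "\<And>j. c = fst (s j) \<Longrightarrow> near (X c) (2 ^ k) u (snd (s j)) \<Longrightarrow> d = fst (t j)"
    and near_t: "\<And>j. d = fst (t j) \<Longrightarrow> near (Y d) (2 ^ k) u (snd (s j)) \<Longrightarrow> c = fst (s j)"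
  shows "game m X Y k (s(z := (c, u))) (t(z := (d, u)))"
proof -
  have rs: "range s \<subseteq> worlds (copies (Suc (2 * m)) X M)"
    and rt: "range t \<subseteq> worlds (copies (Suc (2 * m)) Y M)" using g by (auto simp: game_def)
  have widen: "near X' (2 ^ k) v v' \<Longrightarrow> near X' (2 ^ Suc k) v v'" for X' v v'
    by (rule near_mono[of "2 ^ k"]) auto
  have "fst ` range s \<subseteq> {..<Suc (2 * m)}" "fst ` range t \<subseteq> {..<Suc (2 * m)}"
    using rs rt by (auto simp: copies_def)
  then have "finite (fst ` range s)" "finite (fst ` range t)"
    using finite_subset by blast+
  then have "card (fst ` range (s(z := (c, u)))) + k \<le> m"
    "card (fst ` range (t(z := (d, u)))) + k \<le> m"
    using g card_fst_range_update[of s z "(c, u)"] card_fst_range_update[of t z "(d, u)"]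
    by (auto simp: game_def)
  moreover have "range (s(z := (c, u))) \<subseteq> worlds (copies (Suc (2 * m)) X M)"
    "range (t(z := (d, u))) \<subseteq> worlds (copies (Suc (2 * m)) Y M)"
    using rs rt e d by auto
  moreover have "snd ((t(z := (d, u))) i) = snd ((s(z := (c, u))) i)" for i
    using g by (auto simp: game_def)
  moreover have "X (fst ((s(z := (c, u))) i)) = Y (fst ((t(z := (d, u))) i)) \<or>
      depth (snd ((s(z := (c, u))) i)) + 2 ^ k \<le> r" for i
  proof -
    have "X (fst (s i)) = Y (fst (t i)) \<or> depth (snd (s i)) + 2 ^ Suc k \<le> r"
      using g unfolding game_def by blast
    then show ?thesis using loc by (cases "i = z") auto
  qed
  moreover have "fst ((t(z := (d, u))) i) = fst ((t(z := (d, u))) j)"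
    if *: "fst ((s(z := (c, u))) i) = fst ((s(z := (c, u))) j)"
      "near (X (fst ((s(z := (c, u))) i))) (2 ^ k) (snd ((s(z := (c, u))) i)) (snd ((s(z := (c, u))) j))"
    for i j
  proof (cases "i = z \<or> j = z")
    case True
    then show ?thesis using * near_s[of j] near_s[of i, OF _ near_sym]
      by (cases "i = z"; cases "j = z") auto
  next
    case False
    moreover from this have "fst (s i) = fst (s j) \<longrightarrow>
        near (X (fst (s i))) (2 ^ Suc k) (snd (s i)) (snd (s j)) \<longrightarrow> fst (t i) = fst (t j)"
      using g unfolding game_def by blast
    ultimately show ?thesis using * widen by simp
  qed
  moreover have "fst ((s(z := (c, u))) i) = fst ((s(z := (c, u))) j)"
    if *: "fst ((t(z := (d, u))) i) = fst ((t(z := (d, u))) j)"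
      "near (Y (fst ((t(z := (d, u))) i))) (2 ^ k) (snd ((s(z := (c, u))) i)) (snd ((s(z := (c, u))) j))"
    for i j
  proof (cases "i = z \<or> j = z")
    case True
    then show ?thesis using * near_t[of j] near_t[of i, OF _ near_sym]
      by (cases "i = z"; cases "j = z") auto
  next
    case False
    moreover from this have "fst (t i) = fst (t j) \<longrightarrow>
        near (Y (fst (t i))) (2 ^ Suc k) (snd (s i)) (snd (s j)) \<longrightarrow> fst (s i) = fst (s j)"
      using g unfolding game_def by blast
    ultimately show ?thesis using * widen by simp
  qed
  ultimately show ?thesis unfolding game_def by blast
qed

lemma game_step:
  assumes X: "family m X" and Y: "family m Y" and g: "game m X Y (Suc k) s t"
    and e: "e \<in> worlds (copies (Suc (2 * m)) X M)"
  shows "\<exists>f\<in>worlds (copies (Suc (2 * m)) Y M). game m X Y k (s(z := e)) (t(z := f))"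
proof -
  obtain c u where cu: "e = (c, u)" by force
  have u: "u \<in> worlds M" "u \<in> X c" "c < Suc (2 * m)" using e cu by (auto simp: copies_def)
  have inner_le: "inner \<subseteq> X i" "inner \<subseteq> Y i" for i using X Y family_inner by blast+
  have rt: "range t \<subseteq> worlds (copies (Suc (2 * m)) Y M)" using g by (auto simp: game_def)
  have snd_t: "snd (t i) = snd (s i)" for i using g by (auto simp: game_def)
  have g_s: "fst (s i) = fst (s j) \<Longrightarrow> near (X (fst (s i))) (2 ^ Suc k) (snd (s i)) (snd (s j)) \<Longrightarrow>
        fst (t i) = fst (t j)"
    and g_t: "fst (t i) = fst (t j) \<Longrightarrow> near (Y (fst (t i))) (2 ^ Suc k) (snd (s i)) (snd (s j)) \<Longrightarrow>
        fst (s i) = fst (s j)" for i j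
    using g unfolding game_def by blast+
  have join: "near X' (2 ^ k) a b \<Longrightarrow> near X' (2 ^ k) b b' \<Longrightarrow> near X' (2 ^ Suc k) a b'" for X' a b b'
    using near_trans[of X' "2 ^ k" a b "2 ^ k" b'] by (simp add: mult_2)
  show ?thesis
  proof (cases "\<exists>i. fst (s i) = c \<and> near (X c) (2 ^ k) (snd (s i)) u")
    case True
    then obtain i where i: "fst (s i) = c" "near (X c) (2 ^ k) (snd (s i)) u" by blast
    define d where "d = fst (t i)"
    have ti: "d < Suc (2 * m)" 
      using rt unfolding d_def by (cases "t i") (auto simp: copies_def image_subset_iff dest: spec[of _ i])
    have loc: "X c = Y d \<or> depth (snd (s i)) + 2 ^ Suc k \<le> r"
      using g i d_def unfolding game_def by metis
    have *: "u \<in> Y d \<and> (X c = Y d \<or> depth u + 2 ^ k \<le> r) \<and> near (Y d) (2 ^ k) (snd (s i)) u"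
      using loc
    proof
      assume "X c = Y d"
      then show ?thesis using i u by simp
    next
      \<comment> \<open>Reaching \<open>u\<close> spends half of the radius
        \<open>2 ^ Suc k\<close>; the other half still fits around \<open>u\<close>.\<close>
      assume r: "depth (snd (s i)) + 2 ^ Suc k \<le> r"
      then have "near (Y d) (2 ^ k) (snd (s i)) u \<and> depth u \<le> depth (snd (s i)) + 2 ^ k"
        using near_inner[OF i(2), of "Y d"] inner_le by simp
      moreover from this have "depth u + 2 ^ k \<le> r" using r by simp
      moreover from this have "u \<in> inner" by (simp add: inner_def)
      ultimately show ?thesis using inner_le by blast
    qed
    have "game m X Y k (s(z := (c, u))) (t(z := (d, u)))"
    proof (rule game_update[OF g])
      show "(c, u) \<in> worlds (copies (Suc (2 * m)) X M)" using e cu by simp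
      show "(d, u) \<in> worlds (copies (Suc (2 * m)) Y M)" using * u ti by (simp add: copies_def)
      show "X c = Y d \<or> depth u + 2 ^ k \<le> r" using * by blast
    next
      \<comment> \<open>By the triangle inequality through \<open>u\<close>, pebbles
        \<open>i\<close> and \<open>j\<close> are within \<open>2 ^ Suc k\<close>, where the old
        invariant applies.\<close>
      fix j assume "c = fst (s j)" "near (X c) (2 ^ k) u (snd (s j))"
      then show "d = fst (t j)" using g_s[of i j] join i d_def by metis
    next
      fix j assume "d = fst (t j)" "near (Y d) (2 ^ k) u (snd (s j))"
      then show "c = fst (s j)" using g_t[of i j] join * i d_def by metis
    qed
    then show ?thesis using * u ti cu by (intro bexI[of _ "(d, u)"]) (auto simp: copies_def)
  next
    case False
    have "fst ` range t \<subseteq> {..<Suc (2 * m)}" using rt by (auto simp: copies_def)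
    then have "finite (fst ` range t)" using finite_subset by blast
    moreover have "card (fst ` range t) < m" using g by (auto simp: game_def)
    \<comment> \<open>Fewer than \<open>m\<close> copies are occupied, so a spare one of the kind of
      \<open>X c\<close> is still empty, and the answer is far from every pebble.\<close>
    ultimately obtain d where d: "d < Suc (2 * m)" "d \<notin> fst ` range t" "Y d = X c"
      using family_fresh[OF X Y] by blast
    have "game m X Y k (s(z := (c, u))) (t(z := (d, u)))"
    proof (rule game_update[OF g])
      show "(c, u) \<in> worlds (copies (Suc (2 * m)) X M)" using e cu by simp
      show "(d, u) \<in> worlds (copies (Suc (2 * m)) Y M)" using d u by (simp add: copies_def)
      show "X c = Y d \<or> depth u + 2 ^ k \<le> r" using d by simp
    next
      fix j assume "c = fst (s j)" "near (X c) (2 ^ k) u (snd (s j))"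
      then show "d = fst (t j)" using False near_sym by blast
    next
      fix j assume "d = fst (t j)"
      then show "c = fst (s j)" using d by auto
    qed
    then show ?thesis using d u cu by (intro bexI[of _ "(d, u)"]) (auto simp: copies_def)
  qed
qed

text \<open>The invariant settles atoms, since equal or adjacent worlds are within distance 1, which
  is at most \<open>2 ^ k\<close>. Each quantifier costs one round, played from either side by
  \<open>game_sym\<close>.\<close>

lemma game_sat:
  assumes "formula_over P A \<phi>" "qrank \<phi> \<le> k" "game m X Y k s t" "family m X" "family m Y"
  shows "sat (copies (Suc (2 * m)) X M) s \<phi> \<longleftrightarrow> sat (copies (Suc (2 * m)) Y M) t \<phi>"
  using assms(1-3)
proof (induction \<phi> arbitrary: k s t)
  case (FEq i j)
  have "s i = s j \<longleftrightarrow> t i = t j"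
    using FEq(3) near_refl unfolding game_def prod_eq_iff by metis
  then show ?case by simp
next
  case (FPred p i)
  have "s i \<in> worlds (copies (Suc (2 * m)) X M)" "t i \<in> worlds (copies (Suc (2 * m)) Y M)"
    "snd (t i) = snd (s i)"
    using FPred(3) by (auto simp: game_def)
  then show ?case by (auto simp: copies_def)
next
  case (FRel a i j)
  have a: "a \<in> A" using FRel(1) by (simp add: formula_over_def)
  have w: "s n \<in> worlds (copies (Suc (2 * m)) X M)" "t n \<in> worlds (copies (Suc (2 * m)) Y M)"
    "snd (t n) = snd (s n)" for n
    using FRel(3) by (auto simp: game_def)
  have n: "near X' (2 ^ k) u v" if "(u, v) \<in> acc M a" "u \<in> X'" "v \<in> X'" for X' u v
    by (rule near_mono[of 1]) (use that a in \<open>auto simp: near_def step_def\<close>)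
  show ?case
  proof
    assume "sat (copies (Suc (2 * m)) X M) s (FRel a i j)"
    then have *: "fst (s i) = fst (s j)" "snd (s i) \<in> X (fst (s i))" "snd (s j) \<in> X (fst (s i))"
      "(snd (s i), snd (s j)) \<in> acc M a"
      by (auto simp: copies_def)
    then have "fst (t i) = fst (t j)" using FRel(3) n unfolding game_def by blast
    then show "sat (copies (Suc (2 * m)) Y M) t (FRel a i j)"
      using * w[of i] w[of j] by (auto simp: copies_def)
  next
    assume "sat (copies (Suc (2 * m)) Y M) t (FRel a i j)"
    then have *: "fst (t i) = fst (t j)" "snd (s i) \<in> Y (fst (t i))" "snd (s j) \<in> Y (fst (t i))"
      "(snd (s i), snd (s j)) \<in> acc M a"
      using w[of i] w[of j] by (auto simp: copies_def)
    then have "fst (s i) = fst (s j)" using FRel(3) n unfolding game_def by blast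
    then show "sat (copies (Suc (2 * m)) X M) s (FRel a i j)"
      using * w[of i] w[of j] by (auto simp: copies_def)
  qed
next
  case (FNeg \<phi>)
  then have "sat (copies (Suc (2 * m)) X M) s \<phi> \<longleftrightarrow> sat (copies (Suc (2 * m)) Y M) t \<phi>"
    by (intro FNeg.IH) (auto simp: formula_over_def)
  then show ?case by simp
next
  case (FConj \<phi> \<psi>)
  then have "sat (copies (Suc (2 * m)) X M) s \<phi> \<longleftrightarrow> sat (copies (Suc (2 * m)) Y M) t \<phi>"
    "sat (copies (Suc (2 * m)) X M) s \<psi> \<longleftrightarrow> sat (copies (Suc (2 * m)) Y M) t \<psi>"
    by (intro FConj.IH; auto simp: formula_over_def)+
  then show ?case by simp
next
  case (FDisj \<phi> \<psi>)
  then have "sat (copies (Suc (2 * m)) X M) s \<phi> \<longleftrightarrow> sat (copies (Suc (2 * m)) Y M) t \<phi>"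
    "sat (copies (Suc (2 * m)) X M) s \<psi> \<longleftrightarrow> sat (copies (Suc (2 * m)) Y M) t \<psi>"
    by (intro FDisj.IH; auto simp: formula_over_def)+
  then show ?case by simp
next
  case (FEx z \<phi>)
  then obtain k' where k: "k = Suc k'" by (cases k) auto
  have IH: "sat (copies (Suc (2 * m)) X M) s' \<phi> \<longleftrightarrow> sat (copies (Suc (2 * m)) Y M) t' \<phi>"
    if "game m X Y k' s' t'" for s' t'
    by (rule FEx.IH[OF _ _ that]) (use FEx.prems k in \<open>auto simp: formula_over_def\<close>)
  have g: "game m X Y (Suc k') s t" using FEx.prems k by simp
  show ?case
    using game_step[OF assms(4,5) g, of _ z] game_step[OF assms(5,4) game_sym[OF g], of _ z]
      IH game_sym unfolding sat.simps by metis
next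
  case (FAll z \<phi>)
  then obtain k' where k: "k = Suc k'" by (cases k) auto
  have IH: "sat (copies (Suc (2 * m)) X M) s' \<phi> \<longleftrightarrow> sat (copies (Suc (2 * m)) Y M) t' \<phi>"
    if "game m X Y k' s' t'" for s' t'
    by (rule FAll.IH[OF _ _ that]) (use FAll.prems k in \<open>auto simp: formula_over_def\<close>)
  have g: "game m X Y (Suc k') s t" using FAll.prems k by simp
  show ?case
    using game_step[OF assms(4,5) g, of _ z] game_step[OF assms(5,4) game_sym[OF g], of _ z]
      IH game_sym unfolding sat.simps by metis
qed

text \<open>Placing \<open>v\<close> is the first move of the game, and the remaining
  \<open>qrank \<phi>\<close> rounds preserve \<open>\<phi>\<close>. The answer is the same world
  \<open>v\<close> by the invariant, and it lies in copy 0 by safety.\<close>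

lemma sat2_transfer_copies:
  assumes safe: "safe_finite P A x y \<phi>" and \<phi>: "formula_over P A \<phi>" and xy: "x \<noteq> y"
    and r: "2 ^ Suc (qrank \<phi>) \<le> r" and w: "w \<in> worlds M" "depth w = 0"
    and X: "family (qrank \<phi> + 2) X" and Y: "family (qrank \<phi> + 2) Y"
    and sat: "sat2 (restrict_model (X 0) M) x y \<phi> w v"
  shows "sat2 (restrict_model (Y 0) M) x y \<phi> w v"
proof -
  define m where "m = qrank \<phi> + 2"
  let ?X = "copies (Suc (2 * m)) X M" and ?Y = "copies (Suc (2 * m)) Y M"
  let ?s = "\<lambda>_ :: nat. (0 :: nat, w)"
  have fam: "family m X" "family m Y" using X Y m_def by simp_all
  have "inner \<subseteq> X 0" "inner \<subseteq> Y 0" using X Y family_inner by blast+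
  then have w0: "w \<in> X 0" "w \<in> Y 0" using w by (auto simp: inner_def)
  have sX: "sat2 ?X x y \<phi> (0, w) (0, v)"
    using sat sat2_copies_iff[of P A x y \<phi> M w X 0 "Suc (2 * m)"] safe finite_model w w0 by blast
  \<comment> \<open>One copy is occupied and \<open>qrank \<phi> + 1\<close> rounds follow, which
    accounts for \<open>m\<close>. Copy 0 may differ in \<open>X\<close> and \<open>Y\<close>
    because \<open>w\<close> has depth 0 and \<open>r\<close> is at least the initial
    radius.\<close>
  have "game m X Y (Suc (qrank \<phi>)) ?s ?s"
    using w w0 r by (auto simp: game_def copies_def m_def)
  moreover have "(0, v) \<in> worlds ?X" using sX by (simp add: sat2_def)
  ultimately obtain f where f: "f \<in> worlds ?Y" "game m X Y (qrank \<phi>) (?s(y := (0, v))) (?s(y := f))"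
    using game_step[OF fam] by blast
  have upd: "(\<lambda>_. e)(x := e, y := e') = (\<lambda>_. e)(y := e')" for e e' :: "nat \<times> 'w" using xy by auto
  have "sat ?X (?s(y := (0, v))) \<phi>" using sX by (simp add: sat2_def upd)
  then have "sat ?Y (?s(y := f)) \<phi>" using game_sat[OF \<phi> _ f(2) fam] by simp
  moreover have "(0, w) \<in> worlds ?Y" using w w0 by (simp add: copies_def)
  ultimately have "sat2 ?Y x y \<phi> (0, w) f" using f(1) by (simp add: sat2_def upd)
  then obtain v' where v': "f = (0, v')" "sat2 (restrict_model (Y 0) M) x y \<phi> w v'"
    using sat2_copies_iff[of P A x y \<phi> M w Y 0 "Suc (2 * m)"] safe finite_model w w0 by blast
  have "snd ((?s(y := f)) y) = snd ((?s(y := (0, v))) y)" using f(2) unfolding game_def by blast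
  then show ?thesis using v' by simp
qed

lemma sat2_inner_iff:
  assumes "safe_finite P A x y \<phi>" "formula_over P A \<phi>" "x \<noteq> y"
    "2 ^ Suc (qrank \<phi>) \<le> r" "w \<in> worlds M" "depth w = 0"
  shows "sat2 (restrict_model inner M) x y \<phi> w v \<longleftrightarrow> sat2 M x y \<phi> w v"
proof -
  let ?m = "qrank \<phi> + 2"
  \<comment> \<open>The two families differ in copy 0 only.\<close>
  let ?X = "\<lambda>c. if c \<le> ?m then UNIV else inner"
  let ?Y = "?X(0 := inner)"
  have "family ?m ?X" "family ?m ?Y" by (auto simp: family_def)
  then show ?thesis
    using sat2_transfer_copies[OF assms, of ?X ?Y v] sat2_transfer_copies[OF assms, of ?Y ?X v]
    by (auto simp: restrict_model_UNIV)
qed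

end


section \<open>Unravelling\<close>

text \<open>
  A step of a path carries its label, its target and a bit. The bit duplicates every edge of the
  unravelling, so that a node on a distinguished branch always has an off-branch twin.
\<close>

primrec is_path :: "'a set \<Rightarrow> ('w, 'p, 'a) kripke \<Rightarrow> 'w \<Rightarrow> ('a \<times> 'w \<times> bool) list \<Rightarrow> bool" where
  "is_path A M w [] \<longleftrightarrow> True"
| "is_path A M w (e # l) \<longleftrightarrow> fst e \<in> A \<and> (w, fst (snd e)) \<in> acc M (fst e) \<and>
     is_path A M (fst (snd e)) l"

primrec path_end :: "'w \<Rightarrow> ('a \<times> 'w \<times> bool) list \<Rightarrow> 'w" where
  "path_end w [] = w"
| "path_end w (e # l) = path_end (fst (snd e)) l"

lemma path_end_snoc [simp]: "path_end w (l @ [e]) = fst (snd e)"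
  by (induction l arbitrary: w) auto

lemma is_path_snoc [simp]: "is_path A M w (l @ [e]) \<longleftrightarrow>
    is_path A M w l \<and> fst e \<in> A \<and> (path_end w l, fst (snd e)) \<in> acc M (fst e)"
  by (induction l arbitrary: w) auto

lemma is_path_take: "is_path A M w l \<Longrightarrow> is_path A M w (take n l)"
  by (induction l arbitrary: w n) (auto simp: take_Cons split: nat.splits)

lemma is_path_worlds:
  assumes "finite_model P A M" "is_path A M w l" "w \<in> worlds M"
  shows "set l \<subseteq> A \<times> worlds M \<times> UNIV \<and> path_end w l \<in> worlds M"
  using assms(2,3)
proof (induction l arbitrary: w)
  case (Cons e l)
  then have "fst (snd e) \<in> worlds M" using assms(1) by (fastforce simp: finite_model_def)
  then show ?case using Cons by (cases e) auto
qed simp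

text \<open>Without the appended copy of \<open>M\<close>, paths of length \<open>r\<close> would
  lose their successors and the result would in general not be bisimilar to
  \<open>M\<close>.\<close>

definition unravel :: "'a set \<Rightarrow> nat \<Rightarrow> ('w, 'p, 'a) kripke \<Rightarrow> 'w \<Rightarrow>
    (('a \<times> 'w \<times> bool) list + 'w, 'p, 'a) kripke" where
  "unravel A r M w =
     \<lparr>worlds = Inl ` {l. is_path A M w l \<and> length l \<le> r} \<union> Inr ` worlds M,
      val = \<lambda>p. Inl ` {l. is_path A M w l \<and> length l \<le> r \<and> path_end w l \<in> val M p} \<union> Inr ` val M p,
      acc = \<lambda>a. {(Inl l, Inl (l @ [(a, v, b)])) |l v b. is_path A M w (l @ [(a, v, b)]) \<and> length l < r} \<union>
        {(Inl l, Inr v) |l v. is_path A M w l \<and> length l = r \<and> (path_end w l, v) \<in> acc M a} \<union>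
        {(Inr u, Inr v) |u v. (u, v) \<in> acc M a}\<rparr>"

text \<open>Edges from paths of length \<open>r\<close> enter the appended copy and never leave it.
  With constant height \<open>Suc r\<close> there, edges change the height by at most one and
  heights up to \<open>r\<close> single out the tree.\<close>

definition height :: "nat \<Rightarrow> 'b list + 'w \<Rightarrow> nat" where
  "height r = case_sum length (\<lambda>_. Suc r)"

lemma finite_model_unravel:
  assumes "finite A" "finite_model P A M" "w \<in> worlds M"
  shows "finite_model P A (unravel A r M w)"
proof -
  have "{l. is_path A M w l \<and> length l \<le> r} \<subseteq> {l. set l \<subseteq> A \<times> worlds M \<times> UNIV \<and> length l \<le> r}"
    using is_path_worlds[OF assms(2) _ assms(3)] by blast
  moreover have "finite {l. set l \<subseteq> A \<times> worlds M \<times> (UNIV :: bool set) \<and> length l \<le> r}"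
    using assms(1,2) by (intro finite_lists_length_le) (auto simp: finite_model_def)
  ultimately have "finite {l. is_path A M w l \<and> length l \<le> r}" using finite_subset by blast
  moreover have "(path_end w l, v) \<in> acc M a \<Longrightarrow> a \<in> A \<Longrightarrow> v \<in> worlds M" for l v a
    using assms(2) by (auto simp: finite_model_def)
  ultimately show ?thesis using assms(2) unfolding finite_model_def unravel_def
    by (fastforce simp: finite_model_def)
qed

lemma layered_model_unravel:
  assumes "finite A" "finite_model P A M" "w \<in> worlds M"
  shows "layered_model P A (unravel A r M w) (height r)"
  by (intro layered_model.intro finite_model_unravel assms) (auto simp: unravel_def height_def)

lemma bisimulation_unravel:
  assumes A: "finite A" and M: "finite_model P A M" and w: "w \<in> worlds M"
  shows "bisimulation P A (unravel A r M w) M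
    {(e, case_sum (path_end w) id e) |e. e \<in> worlds (unravel A r M w)}"
    (is "bisimulation P A ?U M ?Z")
proof (rule bisimulationI)
  fix e u assume "(e, u) \<in> ?Z"
  then have e: "e \<in> worlds ?U" "u = case_sum (path_end w) id e" by auto
  show "e \<in> worlds ?U \<and> u \<in> worlds M"
    using e is_path_worlds[OF M _ w] by (auto simp: unravel_def)
  show "e \<in> val ?U p \<longleftrightarrow> u \<in> val M p" for p
    using e by (auto simp: unravel_def)
next
  fix e u a f assume "(e, u) \<in> ?Z" and a: "a \<in> A" "(e, f) \<in> acc ?U a"
  then have e: "e \<in> worlds ?U" "u = case_sum (path_end w) id e" by auto
  have "acc ?U a \<subseteq> worlds ?U \<times> worlds ?U"
    using finite_model_unravel[OF A M w] a(1) by (simp add: finite_model_def)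
  then have "f \<in> worlds ?U" using a(2) by blast
  moreover have "(u, case_sum (path_end w) id f) \<in> acc M a"
    using a(2) e(2) by (auto simp: unravel_def)
  ultimately show "\<exists>v. (u, v) \<in> acc M a \<and> (f, v) \<in> ?Z" by blast
next
  fix e u a v assume "(e, u) \<in> ?Z" and a: "a \<in> A" "(u, v) \<in> acc M a"
  then have e: "e \<in> worlds ?U" and a: "a \<in> A" "(case_sum (path_end w) id e, v) \<in> acc M a" by auto
  have v: "v \<in> worlds M" using a M by (auto simp: finite_model_def)
  have "\<exists>f. (e, f) \<in> acc ?U a \<and> v = case_sum (path_end w) id f \<and> f \<in> worlds ?U"
  proof (cases e)
    case (Inl l)
    then have l: "is_path A M w l" "length l \<le> r" using e by (auto simp: unravel_def)
    \<comment> \<open>A leaf continues in the appended copy; a shorter path is prolonged, and either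
      bit would do.\<close>
    show ?thesis
    proof (cases "length l = r")
      case True
      then show ?thesis using a l v Inl by (intro exI[of _ "Inr v"]) (auto simp: unravel_def)
    next
      case False
      then show ?thesis using a l Inl
        by (intro exI[of _ "Inl (l @ [(a, v, True)])"]) (auto simp: unravel_def)
    qed
  next
    case (Inr u)
    then show ?thesis using a v by (intro exI[of _ "Inr v"]) (auto simp: unravel_def)
  qed
  then show "\<exists>f. (e, f) \<in> acc ?U a \<and> (f, v) \<in> ?Z" by blast
qed

lemma sat2_unravel_forth:
  assumes "safe_finite P A x y \<phi>" "finite A" "finite_model P A M" "w \<in> worlds M"
    and "sat2 (unravel A r M w) x y \<phi> (Inl []) e"
  shows "sat2 M x y \<phi> w (case_sum (path_end w) id e)"
proof -
  have "(Inl [], w) \<in> {(e, case_sum (path_end w) id e) |e. e \<in> worlds (unravel A r M w)}"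
    by (simp add: unravel_def)
  from safe_finite_forth[OF assms(1) finite_model_unravel[OF assms(2-4)] assms(3)
      bisimulation_unravel[OF assms(2-4)] this assms(5)]
  show ?thesis by blast
qed

lemma sat2_unravel_back:
  assumes "safe_finite P A x y \<phi>" "finite A" "finite_model P A M" "w \<in> worlds M"
    and "sat2 M x y \<phi> w v"
  shows "\<exists>e. sat2 (unravel A r M w) x y \<phi> (Inl []) e \<and> v = case_sum (path_end w) id e"
proof -
  have "(Inl [], w) \<in> {(e, case_sum (path_end w) id e) |e. e \<in> worlds (unravel A r M w)}"
    by (simp add: unravel_def)
  from safe_finite_back[OF assms(1) finite_model_unravel[OF assms(2-4)] assms(3)
      bisimulation_unravel[OF assms(2-4)] this assms(5)]
  show ?thesis by blast
qed

definition tree :: "'a set \<Rightarrow> nat \<Rightarrow> ('w, 'p, 'a) kripke \<Rightarrow> 'w \<Rightarrow>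
    (('a \<times> 'w \<times> bool) list + 'w, 'p, 'a) kripke" where
  "tree A r M w = restrict_model {e. height r e \<le> r} (unravel A r M w)"

lemma worlds_tree: "worlds (tree A r M w) = Inl ` {l. is_path A M w l \<and> length l \<le> r}"
  by (auto simp: tree_def restrict_model_def unravel_def height_def)

lemma val_tree: "Inl l \<in> val (tree A r M w) p \<longleftrightarrow>
    is_path A M w l \<and> length l \<le> r \<and> path_end w l \<in> val M p"
  by (auto simp: tree_def restrict_model_def unravel_def height_def)

lemma acc_tree: "(Inl l, e) \<in> acc (tree A r M w) a \<longleftrightarrow>
    (\<exists>v b. e = Inl (l @ [(a, v, b)]) \<and> is_path A M w (l @ [(a, v, b)]) \<and> length l < r)"
  by (auto simp: tree_def restrict_model_def unravel_def height_def)

lemma finite_model_tree: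
  assumes "finite A" "finite_model P A M" "w \<in> worlds M"
  shows "finite_model P A (tree A r M w)"
  unfolding tree_def
  by (rule finite_model_restrict[OF finite_model_unravel[OF assms], of "Inl []"])
    (auto simp: unravel_def height_def)

text \<open>Bisimulation alone does not give this, since leaves of the tree lose their successors;
  the locality argument does.\<close>

lemma sat2_tree_iff:
  assumes "safe_finite P A x y \<phi>" "formula_over P A \<phi>" "x \<noteq> y" "2 ^ Suc (qrank \<phi>) \<le> r"
    and "finite A" "finite_model P A M" "w \<in> worlds M"
  shows "sat2 (tree A r M w) x y \<phi> (Inl []) e \<longleftrightarrow> sat2 (unravel A r M w) x y \<phi> (Inl []) e"
proof -
  interpret layered_model P A "unravel A r M w" "height r" r
    using layered_model_unravel[OF assms(5-7)] .
  have "tree A r M w = restrict_model inner (unravel A r M w)" by (simp add: tree_def inner_def)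
  then show ?thesis using sat2_inner_iff[OF assms(1-4), of "Inl []" e]
    by (simp add: unravel_def height_def)
qed


section \<open>Types of bounded depth\<close>

text \<open>The grammar has no constants. A run of \<open>\<beta>\<close> cannot follow a successful
  test that \<open>\<beta>\<close> has none, so the negated composition is the identity.\<close>

definition skip :: "('p, 'a) prog \<Rightarrow> ('p, 'a) prog" where
  "skip \<beta> = Tilde (Seq (Tilde \<beta>) \<beta>)"

text \<open>All sign patterns over the list: \<open>Tilde (Tilde \<tau>)\<close> tests that
  \<open>\<tau>\<close> can run, \<open>Tilde \<tau>\<close> that it cannot. Each resulting program
  is a test.\<close>

primrec signs :: "('p, 'a) prog \<Rightarrow> ('p, 'a) prog list \<Rightarrow> ('p, 'a) prog list" where
  "signs \<beta> [] = [skip \<beta>]"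
| "signs \<beta> (\<tau> # L) =
     concat (map (\<lambda>\<chi>. [Seq (Tilde (Tilde \<tau>)) \<chi>, Seq (Tilde \<tau>) \<chi>]) (signs \<beta> L))"

lemma runs_skip: "runs M (skip \<beta>) u v \<longleftrightarrow> u = v"
  by (auto simp: skip_def)

lemma program_over_simps:
  "program_over P A (Test p) \<longleftrightarrow> p \<in> P"
  "program_over P A (Atom a) \<longleftrightarrow> a \<in> A"
  "program_over P A (Seq \<pi> \<pi>') \<longleftrightarrow> program_over P A \<pi> \<and> program_over P A \<pi>'"
  "program_over P A (Choice \<pi> \<pi>') \<longleftrightarrow> program_over P A \<pi> \<and> program_over P A \<pi>'"
  "program_over P A (Tilde \<pi>) \<longleftrightarrow> program_over P A \<pi>"
  by (auto simp: program_over_def)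

lemma signs_program_over:
  assumes "program_over P A \<beta>" "\<And>\<tau>. \<tau> \<in> set L \<Longrightarrow> program_over P A \<tau>" "\<chi> \<in> set (signs \<beta> L)"
  shows "program_over P A \<chi>"
  using assms(2,3)
  by (induction L arbitrary: \<chi>) (auto simp: program_over_simps skip_def assms(1))

lemma signs_runs_eq: "\<chi> \<in> set (signs \<beta> L) \<Longrightarrow> runs M \<chi> u v \<Longrightarrow> u = v"
  by (induction L arbitrary: \<chi>) (auto simp: runs_skip)

lemma signs_exists: "u \<in> worlds M \<Longrightarrow> \<exists>\<chi>\<in>set (signs \<beta> L). runs M \<chi> u u"
proof (induction L)
  case (Cons \<tau> L)
  then obtain \<chi> where \<chi>: "\<chi> \<in> set (signs \<beta> L)" "runs M \<chi> u u" by blast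
  show ?case
  proof (cases "\<exists>z\<in>worlds M. runs M \<tau> u z")
    case True
    then have "runs M (Seq (Tilde (Tilde \<tau>)) \<chi>) u u" using \<chi> Cons.prems by auto
    then show ?thesis using \<chi> by auto
  next
    case False
    then have "runs M (Seq (Tilde \<tau>) \<chi>) u u" using \<chi> Cons.prems by auto
    then show ?thesis using \<chi> by auto
  qed
qed (simp add: runs_skip)

lemma signs_agree:
  assumes "\<chi> \<in> set (signs \<beta> L)" "runs M \<chi> u u" "runs N \<chi> u' u'" "\<tau> \<in> set L"
  shows "(\<exists>z\<in>worlds M. runs M \<tau> u z) \<longleftrightarrow> (\<exists>z\<in>worlds N. runs N \<tau> u' z)"
  using assms
proof (induction L arbitrary: \<chi>)
  case (Cons \<sigma> L)
  from Cons.prems(1) obtain \<chi>' where \<chi>': "\<chi>' \<in> set (signs \<beta> L)"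
    "\<chi> = Seq (Tilde (Tilde \<sigma>)) \<chi>' \<or> \<chi> = Seq (Tilde \<sigma>) \<chi>'" by auto
  then have "runs M \<chi>' u u" "runs N \<chi>' u' u'" using Cons.prems by auto
  then have "\<tau> \<in> set L \<Longrightarrow> ?case" using Cons.IH[OF \<chi>'(1)] by blast
  moreover have "\<tau> = \<sigma> \<Longrightarrow> ?case" using \<chi>'(2) Cons.prems(2,3) by auto
  ultimately show ?case using Cons.prems(4) by auto
qed simp

text \<open>Lists enumerate the finite signature, so that types can be enumerated as well;
  \<open>\<beta>\<close> serves to build the identity and the empty program.\<close>

context
  fixes \<beta> :: "('p, 'a) prog" and ps :: "'p list" and as :: "'a list"
begin

text \<open>Hintikka formulas of modal depth \<open>k\<close>, written as tests: they fix the
  propositional variables and which labels lead to which types of depth one less.\<close>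

primrec types :: "nat \<Rightarrow> ('p, 'a) prog list" where
  "types 0 = signs \<beta> (map Test ps)"
| "types (Suc k) = signs \<beta> (map Test ps @ [Seq (Atom a) \<chi>. a \<leftarrow> as, \<chi> \<leftarrow> types k])"

declare types.simps [simp del]

text \<open>Alternations of types and atoms with at most \<open>k\<close> atoms; the type after
  \<open>i\<close> atoms has depth \<open>k - i\<close>.\<close>

primrec path_programs :: "nat \<Rightarrow> ('p, 'a) prog list" where
  "path_programs 0 = types 0"
| "path_programs (Suc k) = types (Suc k) @
     [Seq \<chi> (Seq (Atom a) \<pi>). \<chi> \<leftarrow> types (Suc k), a \<leftarrow> as, \<pi> \<leftarrow> path_programs k]"

definition same_type :: "nat \<Rightarrow> ('w, 'p, 'a) kripke \<Rightarrow> 'w \<Rightarrow> ('v, 'p, 'a) kripke \<Rightarrow> 'v \<Rightarrow> bool" where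
  "same_type k M u N u' \<longleftrightarrow> (\<exists>\<chi>\<in>set (types k). runs M \<chi> u u \<and> runs N \<chi> u' u')"

lemma types_program_over:
  assumes "program_over (set ps) (set as) \<beta>"
  shows "\<chi> \<in> set (types k) \<Longrightarrow> program_over (set ps) (set as) \<chi>"
proof (induction k arbitrary: \<chi>)
  case 0
  then show ?case unfolding types.simps
    by (rule signs_program_over[OF assms, rotated]) (auto simp: program_over_simps)
next
  case (Suc k)
  from Suc.prems show ?case unfolding types.simps
    by (rule signs_program_over[OF assms, rotated]) (auto simp: program_over_simps Suc.IH)
qed

lemma path_programs_Suc: "\<pi> \<in> set (path_programs (Suc k)) \<longleftrightarrow> \<pi> \<in> set (types (Suc k)) \<or>
    (\<exists>\<chi>\<in>set (types (Suc k)). \<exists>a\<in>set as. \<exists>\<pi>'\<in>set (path_programs k). \<pi> = Seq \<chi> (Seq (Atom a) \<pi>'))"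
  by (simp add: image_iff)

lemma path_programs_program_over:
  assumes "program_over (set ps) (set as) \<beta>"
  shows "\<pi> \<in> set (path_programs k) \<Longrightarrow> program_over (set ps) (set as) \<pi>"
proof (induction k arbitrary: \<pi>)
  case 0
  then show ?case using types_program_over[OF assms] by simp
next
  case (Suc k)
  from Suc.prems consider "\<pi> \<in> set (types (Suc k))"
    | \<chi> a \<pi>' where "\<pi> = Seq \<chi> (Seq (Atom a) \<pi>')" "\<chi> \<in> set (types (Suc k))" "a \<in> set as"
      "\<pi>' \<in> set (path_programs k)"
    unfolding path_programs_Suc by blast
  then show ?case
    using types_program_over[OF assms] Suc.IH by cases (simp_all add: program_over_simps)
qed

lemma types_subset_path_programs: "set (types k) \<subseteq> set (path_programs k)"
  by (cases k) simp_all

lemma types_signs: "\<exists>L. types k = signs \<beta> L \<and> Test ` set ps \<subseteq> set L"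
proof (cases k)
  case 0
  then show ?thesis by (intro exI[of _ "map Test ps"]) (simp add: types.simps)
next
  case (Suc k')
  show ?thesis unfolding Suc types.simps by (intro exI conjI, rule refl) simp
qed

lemma types_Suc_signs:
  "\<exists>L. types (Suc k) = signs \<beta> L \<and> (\<forall>a\<in>set as. \<forall>\<chi>\<in>set (types k). Seq (Atom a) \<chi> \<in> set L)"
  unfolding types.simps by (intro exI conjI, rule refl) auto

lemma types_runs_eq: "\<chi> \<in> set (types k) \<Longrightarrow> runs M \<chi> u v \<Longrightarrow> u = v"
  using types_signs[of k] signs_runs_eq by metis

lemma types_exists: "u \<in> worlds M \<Longrightarrow> \<exists>\<chi>\<in>set (types k). runs M \<chi> u u"
  using types_signs[of k] signs_exists by metis

lemma same_type_sym: "same_type k M u N u' \<Longrightarrow> same_type k N u' M u"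
  unfolding same_type_def by blast

lemma same_type_val:
  assumes "same_type k M u N u'" "p \<in> set ps" "u \<in> worlds M" "u' \<in> worlds N"
  shows "u \<in> val M p \<longleftrightarrow> u' \<in> val N p"
proof -
  obtain L where L: "types k = signs \<beta> L" "Test p \<in> set L" using types_signs[of k] assms(2) by blast
  obtain \<chi> where \<chi>: "\<chi> \<in> set (signs \<beta> L)" "runs M \<chi> u u" "runs N \<chi> u' u'"
    using assms(1) L(1) unfolding same_type_def by metis
  show ?thesis using signs_agree[OF \<chi> L(2)] assms(3,4) by auto
qed

text \<open>The type \<open>\<psi>\<close> of \<open>v\<close> at depth \<open>k\<close> makes
  \<open>Seq (Atom a) \<psi>\<close> runnable at \<open>u\<close>, a fact recorded by every type of
  depth \<open>Suc k\<close>, hence shared by \<open>u'\<close>.\<close>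

lemma same_type_forth:
  assumes "same_type (Suc k) M u N u'" "a \<in> set as" "(u, v) \<in> acc M a" "v \<in> worlds M"
  shows "\<exists>v'. (u', v') \<in> acc N a \<and> same_type k M v N v'"
proof -
  obtain \<psi> where \<psi>: "\<psi> \<in> set (types k)" "runs M \<psi> v v" 
    using types_exists[OF assms(4), of k] by blast
  obtain L where L: "types (Suc k) = signs \<beta> L" "Seq (Atom a) \<psi> \<in> set L"
    using types_Suc_signs[of k] assms(2) \<psi>(1) by blast
  obtain \<chi> where \<chi>: "\<chi> \<in> set (signs \<beta> L)" "runs M \<chi> u u" "runs N \<chi> u' u'"
    using assms(1) L(1) unfolding same_type_def by metis
  have "\<exists>z\<in>worlds M. runs M (Seq (Atom a) \<psi>) u z" using \<psi>(2) assms(3,4) by auto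
  then obtain z where "runs N (Seq (Atom a) \<psi>) u' z" using signs_agree[OF \<chi> L(2)] by blast
  then obtain v' where "(u', v') \<in> acc N a" "runs N \<psi> v' z" by auto
  \<comment> \<open>Types are tests, so the run of \<open>\<psi>\<close> stays at the
    \<open>a\<close>-successor.\<close>
  moreover from this have "v' = z" by (intro types_runs_eq[OF \<psi>(1)])
  ultimately show ?thesis using \<psi> unfolding same_type_def by blast
qed

section \<open>Matching branches: path programs and bisimulations between trees\<close>

definition same_type_path :: "nat \<Rightarrow> ('w, 'p, 'a) kripke \<Rightarrow> 'w \<Rightarrow> ('a \<times> 'w \<times> bool) list \<Rightarrow>
    ('v, 'p, 'a) kripke \<Rightarrow> 'v \<Rightarrow> ('a \<times> 'v \<times> bool) list \<Rightarrow> bool" where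
  "same_type_path k M w l N w' l' \<longleftrightarrow> length l = length l' \<and> length l \<le> k \<and>
     (\<forall>i\<le>length l. same_type (k - i) M (path_end w (take i l)) N (path_end w' (take i l'))) \<and>
     (\<forall>i<length l. fst (l ! i) = fst (l' ! i))"

lemma same_type_path_sym:
  assumes "same_type_path k M w l N w' l'"
  shows "same_type_path k N w' l' M w l"
proof -
  have "same_type (k - i) N (path_end w' (take i l')) M (path_end w (take i l))"
    if "i \<le> length l" for i
    by (rule same_type_sym) (use assms that in \<open>simp add: same_type_path_def\<close>)
  then show ?thesis using assms by (simp add: same_type_path_def)
qed

lemma same_type_path_Cons:
  assumes "same_type (Suc k) M w N w'" "same_type_path k M v l N v' l'"
  shows "same_type_path (Suc k) M w ((a, v, b) # l) N w' ((a, v', b') # l')"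
  unfolding same_type_path_def
proof (intro conjI allI impI)
  fix i assume "i \<le> length ((a, v, b) # l)"
  then show "same_type (Suc k - i) M (path_end w (take i ((a, v, b) # l)))
      N (path_end w' (take i ((a, v', b') # l')))"
    using assms by (cases i) (simp_all add: same_type_path_def)
next
  fix i assume "i < length ((a, v, b) # l)"
  then show "fst (((a, v, b) # l) ! i) = fst (((a, v', b') # l') ! i)"
    using assms(2) by (cases i) (simp_all add: same_type_path_def)
qed (use assms(2) in \<open>simp_all add: same_type_path_def\<close>)

text \<open>The program spells out the types and labels met along \<open>l\<close>. A run of it
  elsewhere must pass through the same types and labels, and its intermediate points form the
  matching path.\<close>

lemma path_program_exists:
  fixes M :: "('w, 'p, 'a) kripke"
  assumes M: "finite_model P (set as) M"
  shows "is_path (set as) M w l \<Longrightarrow> length l \<le> k \<Longrightarrow> w \<in> worlds M \<Longrightarrow>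
    \<exists>\<pi>\<in>set (path_programs k). runs M \<pi> w (path_end w l) \<and>
      (\<forall>(N :: ('v, 'p, 'a) kripke) w' v'. runs N \<pi> w' v' \<longrightarrow>
        (\<exists>l'. is_path (set as) N w' l' \<and> path_end w' l' = v' \<and> same_type_path k M w l N w' l'))"
proof (induction l arbitrary: w k)
  case Nil
  obtain \<chi> where \<chi>: "\<chi> \<in> set (types k)" "runs M \<chi> w w" using types_exists[OF Nil(3), of k] by blast
  have "\<exists>l'. is_path (set as) N w' l' \<and> path_end w' l' = v' \<and> same_type_path k M w [] N w' l'"
    if "runs N \<chi> w' v'" for N :: "('v, 'p, 'a) kripke" and w' v'
  proof -
    have "w' = v'" by (rule types_runs_eq[OF \<chi>(1) that])
    then show ?thesis using \<chi> that
      by (intro exI[of _ "[]"]) (auto simp: same_type_path_def same_type_def)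
  qed
  then show ?case using \<chi> types_subset_path_programs[of k] by (intro bexI[of _ \<chi>]) auto
next
  case (Cons e l)
  obtain a v b where e: "e = (a, v, b)" by (cases e)
  obtain k' where k: "k = Suc k'" using Cons.prems(2) by (cases k) auto
  have p: "a \<in> set as" "(w, v) \<in> acc M a" "is_path (set as) M v l" "length l \<le> k'"
    using Cons.prems e k by auto
  then have v: "v \<in> worlds M" using M by (auto simp: finite_model_def)
  obtain \<pi> where \<pi>: "\<pi> \<in> set (path_programs k')" "runs M \<pi> v (path_end v l)"
    "\<And>(N :: ('v, 'p, 'a) kripke) w' v'. runs N \<pi> w' v' \<Longrightarrow>
      \<exists>l'. is_path (set as) N w' l' \<and> path_end w' l' = v' \<and> same_type_path k' M v l N w' l'"
    using Cons.IH[OF p(3,4) v] by blast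
  obtain \<chi> where \<chi>: "\<chi> \<in> set (types k)" "runs M \<chi> w w"
    using types_exists[OF Cons.prems(3), of k] by blast
  let ?\<pi> = "Seq \<chi> (Seq (Atom a) \<pi>)"
  have "?\<pi> \<in> set (path_programs k)" unfolding k path_programs_Suc using \<chi>(1) \<pi>(1) p(1) k by blast
  moreover have "runs M ?\<pi> w (path_end w (e # l))"
    using \<chi>(2) \<pi>(2) p(2) v Cons.prems(3) e by auto
  moreover have "\<exists>l'. is_path (set as) N w' l' \<and> path_end w' l' = v' \<and>
      same_type_path k M w (e # l) N w' l'"
    if r: "runs N ?\<pi> w' v'" for N :: "('v, 'p, 'a) kripke" and w' v'
  proof -
    obtain z z' where z: "runs N \<chi> w' z" "(z, z') \<in> acc N a" "runs N \<pi> z' v'" using r by auto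
    have "w' = z" by (rule types_runs_eq[OF \<chi>(1) z(1)])
    obtain l' where l': "is_path (set as) N z' l'" "path_end z' l' = v'" "same_type_path k' M v l N z' l'"
      using \<pi>(3)[OF z(3)] by blast
    have "same_type (Suc k') M w N w'"
      using \<chi> z(1) \<open>w' = z\<close> k unfolding same_type_def by blast
    then have "same_type_path k M w (e # l) N w' ((a, z', b) # l')"
      unfolding k e by (rule same_type_path_Cons[OF _ l'(3)])
    \<comment> \<open>Bits are invisible to programs; \<open>b\<close> is reused as an arbitrary
      choice.\<close>
    then show ?thesis using l' z(2) \<open>w' = z\<close> p(1)
      by (intro exI[of _ "(a, z', b) # l'"]) simp
  qed
  ultimately show ?case by blast
qed

text \<open>At depth \<open>length m\<close> only \<open>r - length m\<close> levels of the tree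
  remain, hence the depth of the type. The last clause relates nodes on one branch only to nodes on
  the other, so \<open>l\<close> can only meet \<open>l'\<close>.\<close>

definition branch_bisim :: "nat \<Rightarrow> ('w, 'p, 'a) kripke \<Rightarrow> 'w \<Rightarrow> ('a \<times> 'w \<times> bool) list \<Rightarrow>
    ('v, 'p, 'a) kripke \<Rightarrow> 'v \<Rightarrow> ('a \<times> 'v \<times> bool) list \<Rightarrow>
    ((('a \<times> 'w \<times> bool) list + 'w) \<times> (('a \<times> 'v \<times> bool) list + 'v)) set" where
  "branch_bisim r M w l N w' l' = {(Inl m, Inl m') |m m'.
     is_path (set as) M w m \<and> is_path (set as) N w' m' \<and> length m = length m' \<and> length m \<le> r \<and>
     same_type (r - length m) M (path_end w m) N (path_end w' m') \<and>
     (m = take (length m) l \<longleftrightarrow> m' = take (length m) l')}"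

lemma branch_bisimI:
  assumes "is_path (set as) M w m" "is_path (set as) N w' m'" "length m = n" "length m' = n" "n \<le> r"
    "same_type (r - n) M (path_end w m) N (path_end w' m')" "m = take n l \<longleftrightarrow> m' = take n l'"
  shows "(Inl m, Inl m') \<in> branch_bisim r M w l N w' l'"
  unfolding branch_bisim_def mem_Collect_eq
  by (intro exI conjI, rule refl) (use assms in simp_all)

lemma branch_bisim_sym:
  assumes "(e, e') \<in> branch_bisim r M w l N w' l'"
  shows "(e', e) \<in> branch_bisim r N w' l' M w l"
proof -
  obtain m m' where m: "e = Inl m" "e' = Inl m'" "is_path (set as) M w m" "is_path (set as) N w' m'"
    "length m = length m'" "length m \<le> r"
    "same_type (r - length m) M (path_end w m) N (path_end w' m')"
    "m = take (length m) l \<longleftrightarrow> m' = take (length m) l'"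
    using assms unfolding branch_bisim_def by blast
  then show ?thesis using same_type_sym[OF m(7)]
    by (simp only: m(1,2)) (rule branch_bisimI[where n = "length m"], simp_all)
qed

lemma branch_bisim_forth:
  assumes M: "finite_model P (set as) M" and w: "w \<in> worlds M"
    and l: "is_path (set as) M w l" "is_path (set as) N w' l'" "same_type_path r M w l N w' l'"
    and e: "(e, e') \<in> branch_bisim r M w l N w' l'" and a: "a \<in> set as"
    and f: "(e, f) \<in> acc (tree (set as) r M w) a"
  shows "\<exists>f'. (e', f') \<in> acc (tree (set as) r N w') a \<and> (f, f') \<in> branch_bisim r M w l N w' l'"
proof -
  obtain m m' where m: "e = Inl m" "e' = Inl m'" "is_path (set as) M w m" "is_path (set as) N w' m'"
    "length m = length m'" "same_type (r - length m) M (path_end w m) N (path_end w' m')"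
    "m = take (length m) l \<longleftrightarrow> m' = take (length m) l'"
    using e unfolding branch_bisim_def by blast
  obtain v b where f': "f = Inl (m @ [(a, v, b)])" "is_path (set as) M w (m @ [(a, v, b)])" "length m < r"
    using f unfolding m(1) acc_tree by blast
  have len: "length l = length l'" "length l \<le> r" using l(3) by (auto simp: same_type_path_def)
  show ?thesis
  \<comment> \<open>A move along the branch is answered along the other branch; every other move is
    answered by the types, off the branch.\<close>
  proof (cases "m @ [(a, v, b)] = take (Suc (length m)) l")
    case True
    then have lt: "length m < length l"
      by (metis length_append_singleton length_take min.absorb_iff1 Suc_le_eq min.commute)
    then have "take (Suc (length m)) l = take (length m) l @ [l ! length m]"
      by (rule take_Suc_conv_app_nth)
    then have ml: "m = take (length m) l" "l ! length m = (a, v, b)" using True by auto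
    then have m': "m' = take (length m) l'" using m(7) by blast
    obtain v' b' where l': "l' ! length m = (a, v', b')"
      using l(3) lt ml(2) unfolding same_type_path_def by (metis fst_conv prod.collapse)
    have tk: "take (Suc (length m)) l' = m' @ [(a, v', b')]"
      using take_Suc_conv_app_nth[of "length m" l'] lt len m' l' by simp
    then have path: "is_path (set as) N w' (m' @ [(a, v', b')])" using is_path_take[OF l(2)] by metis
    have "same_type (r - Suc (length m)) M (path_end w (m @ [(a, v, b)])) N (path_end w' (m' @ [(a, v', b')]))"
      using l(3) lt True tk unfolding same_type_path_def by (metis Suc_le_eq)
    then have "(f, Inl (m' @ [(a, v', b')])) \<in> branch_bisim r M w l N w' l'"
      unfolding f'(1) by (intro branch_bisimI[where n = "Suc (length m)"])
        (use f' path m(5) True tk lt in simp_all)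
    then show ?thesis using path f'(3) m(5) unfolding m(2) acc_tree by auto
  next
    case False
    have v: "(path_end w m, v) \<in> acc M a" "v \<in> worlds M"
      using f'(2) is_path_worlds[OF M f'(2) w] by auto
    have st: "same_type (Suc (r - Suc (length m))) M (path_end w m) N (path_end w' m')"
      using m(6) f'(3) by (simp add: Suc_diff_Suc)
    obtain v' where v': "(path_end w' m', v') \<in> acc N a" "same_type (r - Suc (length m)) M v N v'"
      using same_type_forth[OF st a v] by blast
    \<comment> \<open>At most one of the two bits gives the branch node, so the other yields an
      off-branch twin with the same end point.\<close>
    obtain b' where b': "m' @ [(a, v', b')] \<noteq> take (Suc (length m)) l'"
      by (metis (full_types) last_snoc prod.inject)
    have path: "is_path (set as) N w' (m' @ [(a, v', b')])" using m(4) a v' by simp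
    have "(f, Inl (m' @ [(a, v', b')])) \<in> branch_bisim r M w l N w' l'"
      unfolding f'(1) by (intro branch_bisimI[where n = "Suc (length m)"])
        (use f' path m(5) False b' v'(2) in simp_all)
    then show ?thesis using path f'(3) m(5) unfolding m(2) acc_tree by auto
  qed
qed

lemma bisimulation_branch_bisim:
  assumes M: "finite_model (set ps) (set as) M" "w \<in> worlds M"
    and N: "finite_model (set ps) (set as) N" "w' \<in> worlds N"
    and l: "is_path (set as) M w l" "is_path (set as) N w' l'" "same_type_path r M w l N w' l'"
  shows "bisimulation (set ps) (set as) (tree (set as) r M w) (tree (set as) r N w')
    (branch_bisim r M w l N w' l')"
proof (rule bisimulationI)
  fix e e' assume e: "(e, e') \<in> branch_bisim r M w l N w' l'"
  show "e \<in> worlds (tree (set as) r M w) \<and> e' \<in> worlds (tree (set as) r N w')"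
    using e unfolding branch_bisim_def worlds_tree by auto
  fix p assume p: "p \<in> set ps"
  obtain m m' where m: "e = Inl m" "e' = Inl m'" "is_path (set as) M w m" "is_path (set as) N w' m'"
    "length m \<le> r" "length m' \<le> r" "same_type (r - length m) M (path_end w m) N (path_end w' m')"
    using e unfolding branch_bisim_def by auto
  have "path_end w m \<in> val M p \<longleftrightarrow> path_end w' m' \<in> val N p"
    using same_type_val[OF m(7) p] is_path_worlds[OF M(1) m(3) M(2)] is_path_worlds[OF N(1) m(4) N(2)]
    by blast
  then show "e \<in> val (tree (set as) r M w) p \<longleftrightarrow> e' \<in> val (tree (set as) r N w') p"
    unfolding m(1,2) val_tree using m by blast
next
  fix e e' a f assume "(e, e') \<in> branch_bisim r M w l N w' l'" "a \<in> set as"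
    "(e, f) \<in> acc (tree (set as) r M w) a"
  then show "\<exists>f'. (e', f') \<in> acc (tree (set as) r N w') a \<and> (f, f') \<in> branch_bisim r M w l N w' l'"
    by (rule branch_bisim_forth[OF M l])
next
  fix e e' a f' assume *: "(e, e') \<in> branch_bisim r M w l N w' l'" "a \<in> set as"
    "(e', f') \<in> acc (tree (set as) r N w') a"
  \<comment> \<open>The construction is symmetric, so the back condition is the forth condition with
    the models exchanged.\<close>
  obtain f where f: "(e, f) \<in> acc (tree (set as) r M w) a" "(f', f) \<in> branch_bisim r N w' l' M w l"
    using branch_bisim_forth[OF N l(2,1) same_type_path_sym[OF l(3)] branch_bisim_sym[OF *(1)] *(2,3)]
    by blast
  then show "\<exists>f. (e, f) \<in> acc (tree (set as) r M w) a \<and> (f, f') \<in> branch_bisim r M w l N w' l'"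
    using branch_bisim_sym[OF f(2)] by blast
qed

lemma sat2_tree_transfer:
  assumes safe: "safe_finite (set ps) (set as) x y \<phi>"
    and M: "finite_model (set ps) (set as) M" "w \<in> worlds M"
    and N: "finite_model (set ps) (set as) N" "w' \<in> worlds N"
    and l: "is_path (set as) M w l" "is_path (set as) N w' l'" "same_type_path r M w l N w' l'"
    and sat: "sat2 (tree (set as) r M w) x y \<phi> (Inl []) (Inl l)"
  shows "sat2 (tree (set as) r N w') x y \<phi> (Inl []) (Inl l')"
proof -
  have len: "length l = length l'" "length l \<le> r" "same_type r M w N w'"
    using l(3) unfolding same_type_path_def by (auto dest: spec[of _ 0])
  then have "(Inl [], Inl []) \<in> branch_bisim r M w l N w' l'" by (auto simp: branch_bisim_def)
  then obtain e where e: "sat2 (tree (set as) r N w') x y \<phi> (Inl []) e"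
    "(Inl l, e) \<in> branch_bisim r M w l N w' l'"
    using safe_finite_forth[OF safe finite_model_tree[OF _ M] finite_model_tree[OF _ N]
        bisimulation_branch_bisim[OF M N l] _ sat] by auto
  \<comment> \<open>\<open>l\<close> is its own prefix of full length, so its partner is the prefix
    of \<open>l'\<close> of that length, which is \<open>l'\<close>.\<close>
  then have "e = Inl l'" using len by (auto simp: branch_bisim_def)
  then show ?thesis using e by simp
qed

section \<open>Assembling the defining program\<close>

lemma safe_finite_program_exists:
  assumes \<beta>: "program_over (set ps) (set as) \<beta>" and safe: "safe_finite (set ps) (set as) x y \<phi>"
    and \<phi>: "formula_over (set ps) (set as) \<phi>" and xy: "x \<noteq> y" "fv \<phi> \<subseteq> {x, y}"
  shows "\<exists>\<pi>. program_over (set ps) (set as) \<pi> \<and> equiv_finite (set ps) (set as) \<phi> (ST x y \<pi>)"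
proof -
  define r :: nat where "r = 2 ^ Suc (qrank \<phi>)"
  \<comment> \<open>A path program is kept if its runs enforce \<open>\<phi>\<close> in all finite
    models; this makes the union of the kept ones sound outright.\<close>
  define good where "good \<pi> \<longleftrightarrow> (\<forall>(N :: (nat, 'p, 'a) kripke) u v. finite_model (set ps) (set as) N \<longrightarrow>
    u \<in> worlds N \<longrightarrow> v \<in> worlds N \<longrightarrow> runs N \<pi> u v \<longrightarrow> sat2 N x y \<phi> u v)" for \<pi>
  define L where "L = filter good (path_programs r)"
  define \<pi> where "\<pi> = foldr Choice L (Seq (Tilde \<beta>) \<beta>)"
  \<comment> \<open>The base of the fold is the empty program. The end point must be a world because
    \<open>Tilde \<beta>\<close> excludes only runs of \<open>\<beta>\<close> that end in
    one.\<close>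
  have runs_fold: "runs N (foldr Choice K (Seq (Tilde \<beta>) \<beta>)) u v \<longleftrightarrow> (\<exists>\<sigma>\<in>set K. runs N \<sigma> u v)"
    if "v \<in> worlds N" for N :: "(nat, 'p, 'a) kripke" and u v K
    using that by (induction K) auto
  have over_fold: "(\<forall>\<sigma>\<in>set K. program_over (set ps) (set as) \<sigma>) \<Longrightarrow>
      program_over (set ps) (set as) (foldr Choice K (Seq (Tilde \<beta>) \<beta>))" for K
    using \<beta> by (induction K) (auto simp: program_over_simps)
  have "program_over (set ps) (set as) \<pi>"
    unfolding \<pi>_def L_def by (rule over_fold) (use path_programs_program_over[OF \<beta>] in auto)
  moreover have "equiv_finite (set ps) (set as) \<phi> (ST x y \<pi>)"
    unfolding equiv_finite_def
  proof (intro allI impI)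
    fix M :: "(nat, 'p, 'a) kripke" and s :: "nat \<Rightarrow> nat"
    assume M: "finite_model (set ps) (set as) M" and s: "range s \<subseteq> worlds M"
    then have w: "s x \<in> worlds M" "s y \<in> worlds M" by auto
    have "sat2 M x y \<phi> (s x) (s y) \<longleftrightarrow> (\<exists>\<sigma>\<in>set L. runs M \<sigma> (s x) (s y))"
    proof
      assume "\<exists>\<sigma>\<in>set L. runs M \<sigma> (s x) (s y)"
      then show "sat2 M x y \<phi> (s x) (s y)" using M w by (auto simp: L_def good_def)
    next
      assume "sat2 M x y \<phi> (s x) (s y)"
      then obtain e where e: "sat2 (unravel (set as) r M (s x)) x y \<phi> (Inl []) e"
        "s y = case_sum (path_end (s x)) id e"
        using sat2_unravel_back[OF safe _ M w(1)] by auto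
      then have t: "sat2 (tree (set as) r M (s x)) x y \<phi> (Inl []) e"
        using sat2_tree_iff[OF safe \<phi> xy(1) _ _ M w(1)] by (simp add: r_def)
      \<comment> \<open>Truth in the tree places the second argument on a node, which is the end of
        its own branch.\<close>
      then obtain l where l: "e = Inl l" "is_path (set as) M (s x) l" "length l \<le> r"
        by (auto simp: sat2_def worlds_tree)
      obtain \<sigma> where \<sigma>: "\<sigma> \<in> set (path_programs r)" "runs M \<sigma> (s x) (path_end (s x) l)"
        "\<And>(N :: (nat, 'p, 'a) kripke) w' v'. runs N \<sigma> w' v' \<Longrightarrow>
          \<exists>l'. is_path (set as) N w' l' \<and> path_end w' l' = v' \<and> same_type_path r M (s x) l N w' l'"
        using path_program_exists[OF M l(2,3) w(1), where 'v = nat] by blast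
      \<comment> \<open>Truth moves from the tree of \<open>M\<close> to the tree of
        \<open>N\<close> along matching branches, then to the unravelling of \<open>N\<close> and
        down to \<open>N\<close>.\<close>
      have "good \<sigma>" unfolding good_def
      proof (intro allI impI)
        fix N :: "(nat, 'p, 'a) kripke" and u v
        assume N: "finite_model (set ps) (set as) N" "u \<in> worlds N" and "runs N \<sigma> u v"
        then obtain l' where l': "is_path (set as) N u l'" "path_end u l' = v"
          "same_type_path r M (s x) l N u l'" using \<sigma>(3) by blast
        have "sat2 (tree (set as) r N u) x y \<phi> (Inl []) (Inl l')"
          using sat2_tree_transfer[OF safe M w(1) N l(2) l'(1,3)] t l(1) by simp
        then have "sat2 (unravel (set as) r N u) x y \<phi> (Inl []) (Inl l')"
          using sat2_tree_iff[OF safe \<phi> xy(1) _ _ N] by (simp add: r_def)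
        then show "sat2 N x y \<phi> u v" using sat2_unravel_forth[OF safe _ N] l'(2) by fastforce
      qed
      then show "\<exists>\<sigma>\<in>set L. runs M \<sigma> (s x) (s y)" using \<sigma>(1,2) e(2) l(1) by (auto simp: L_def)
    qed
    then show "sat M s \<phi> \<longleftrightarrow> sat M s (ST x y \<pi>)"
      using sat_iff_sat2[OF xy(2) s] runs_fold[OF w(2)] by (simp add: sat_ST \<pi>_def)
  qed
  ultimately show ?thesis by blast
qed

end

theorem theorem3p3:
  fixes P :: "'p set" and A :: "'a set" and \<phi> :: "('p, 'a) fm" and x y :: nat
  assumes "P \<noteq> {} \<or> A \<noteq> {}"
    and "formula_over P A \<phi>"
    and "x \<noteq> y" and "fv \<phi> \<subseteq> {x, y}"
  shows "safe_finite P A x y \<phi> \<longleftrightarrow>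
    (\<exists>\<pi>. program_over P A \<pi> \<and> equiv_finite P A \<phi> (ST x y \<pi>))"
proof
  assume safe: "safe_finite P A x y \<phi>"
  \<comment> \<open>A single symbol of the signature already gives a program.\<close>
  obtain \<beta> :: "('p, 'a) prog" where \<beta>: "program_over P A \<beta>"
    using assms(1) program_over_simps(1,2) by (metis ex_in_conv)
  have "finite (prog_preds \<pi>)" "finite (prog_rels \<pi>)" for \<pi> :: "('p, 'a) prog"
    by (induction \<pi>) auto
  \<comment> \<open>The symbols of \<open>\<beta>\<close> are added so that the constants built from
    it remain over the finite signature.\<close>
  then obtain ps as where sig: "set ps = fm_preds \<phi> \<union> prog_preds \<beta>" "set as = fm_rels \<phi> \<union> prog_rels \<beta>"
    using finite_list finite_fm_preds finite_fm_rels by (metis finite_UnI)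
  have sub: "set ps \<subseteq> P" "set as \<subseteq> A"
    using sig assms(2) \<beta> by (auto simp: formula_over_def program_over_def)
  have \<phi>: "formula_over (set ps) (set as) \<phi>" using sig by (auto simp: formula_over_def)
  have "program_over (set ps) (set as) \<beta>" using sig by (auto simp: program_over_def)
  then obtain \<pi> where \<pi>: "program_over (set ps) (set as) \<pi>"
    "equiv_finite (set ps) (set as) \<phi> (ST x y \<pi>)"
    using safe_finite_program_exists safe_finite_subsignature[OF safe sub \<phi>] \<phi> assms(3,4) by blast
  have "program_over P A \<pi>" using \<pi>(1) sub by (auto simp: program_over_def)
  moreover have "finite_model P A M \<Longrightarrow> finite_model (set ps) (set as) M" for M :: "(nat, 'p, 'a) kripke"
    using sub by (auto simp: finite_model_def)
  then have "equiv_finite P A \<phi> (ST x y \<pi>)" using \<pi>(2) unfolding equiv_finite_def by blast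
  ultimately show "\<exists>\<pi>. program_over P A \<pi> \<and> equiv_finite P A \<phi> (ST x y \<pi>)" by blast
next
  assume "\<exists>\<pi>. program_over P A \<pi> \<and> equiv_finite P A \<phi> (ST x y \<pi>)"
  then show "safe_finite P A x y \<phi>" using safe_finite_program assms(3) by blast
qed

end
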